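(* Let $r\in\mathbb N$, $d_1,\dots,d_r>0$, and let $f=(f_1,\dots,f_r)$ be the reaction kinetics. Let the triangulation $\mathcal K_h$ satisfy the angle condition $\alpha_1+\alpha_2\le\pi$ for every edge. Let $\Sigma=\prod_{k=1}^r[m_k,M_k]$ be a hyper-rectangle in the phase space $\mathbb R^r$, let $f$ be Lipschitz on $\Sigma$ and let $\mathbf n$ be the outward unit normal defined piecewise on $\partial\Sigma$. If $$f(u)\cdot\mathbf n(u)<0\qquad\forall\,u\in\partial\Sigma,$$ then $\Sigma$ is an invariant region for the semi-discrete problem: find $U=(U_1,\dots,U_r)$ with $U_k,\dot U_k\in L^2([0,T];S_h)$ such that, for each $k=1,\dots,r$, $$\int_{\Gamma_h}I_h(\dot U_k\phi_k)+d_k\int_{\Gamma_h}\nabla_{\Gamma_h}U_k\cdot\nabla_{\Gamma_h}\phi_k=\int_{\Gamma_h}I_h(f_k(U)\phi_k)\qquad\forall\,\phi_k\in S_h;$$ that is, if $U(\cdot,0)$ takes values in $\Sigma$, then $U(\cdot,t)$ takes values in $\Sigma$ for as long as the solution exists and is unique.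
   Context: $\Gamma\subset\mathbb R^3$ is a compact, orientable, smooth surface without boundary, given as the zero level set of a sufficiently smooth signed distance function $\mathsf d$ defined on an open neighbourhood $W$ of $\Gamma$ with $\nabla\mathsf d\neq 0$ on $W$; its unit normal is $\nu=\nabla \mathsf d/|\nabla\mathsf d|$, and every $x\in W$ is uniquely written as $x=a(x)+\mathsf d(x)\nu(a(x))$ with $a(x)\in\Gamma$. For $h>0$, $\Gamma_h=\bigcup_{K\in\mathcal K_h}K\subset W$ is a closed triangulated surface, where $\mathcal K_h$ is a finite (conforming) set of non-degenerate triangles with diameters at most $h$, whose vertices $x_1,\dots,x_N$ lie on $\Gamma$, and such that $a|_{\Gamma_h}$ is a one-to-one map between $\Gamma_h$ and $\Gamma$. $S_h$ is the space of continuous functions on $\Gamma_h$ that are affine on each $K\in\mathcal K_h$, with nodal basis $\chi_1,\dots,\chi_N$, $\chi_i(x_j)=\delta_{ij}$. For continuous $v$ on $\Gamma_h$, $I_h(v)=\sum_i v(x_i)\chi_i$. $\nabla_{\Gamma_h}$ is the (trianglewise) tangential gradient; the dot is the time derivative. Angle condition: for every edge $e$ of $\mathcal K_h$, if $K_1,K_2$ are the two triangles sharing $e$ and $\alpha_1,\alpha_2$ are the angles of $K_1,K_2$ opposite to $e$, then $\alpha_1+\alpha_2\le\pi$. The kinetics $f_k:\mathbb R^r\to\mathbb R$ are of class $C^2$. Hyper-rectangles may be bounded or unbounded: $m_k,M_k\in\mathbb R\cup\{-\infty,+\infty\}$. The normal being defined piecewise means that the flux condition is imposed on every face of $\Sigma$: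 $f_k(u)<0$ whenever $u\in\Sigma$, $u_k=M_k$, and $f_k(u)>0$ whenever $u\in\Sigma$, $u_k=m_k$. *)

theory Defs
  imports "HOL-Analysis.Analysis"
begin

type_synonym point = "real^3"

section \<open>Smooth functions and the surface\<close>

text \<open>Intended for open \<open>S\<close>. As the domain is finite-dimensional, continuity of all directional
  derivatives of the derivative amounts to its continuity as a map into the linear operators.\<close>

primrec Ck_on :: "nat \<Rightarrow> ('a::euclidean_space \<Rightarrow> 'b::real_normed_vector) \<Rightarrow> 'a set \<Rightarrow> bool" where
  "Ck_on 0 f S \<longleftrightarrow> continuous_on S f"
| "Ck_on (Suc k) f S \<longleftrightarrow>
     (\<forall>x\<in>S. f differentiable (at x)) \<and> (\<forall>v. Ck_on k (\<lambda>x. frechet_derivative f (at x) v) S)"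

definition gradient :: "('a::euclidean_space \<Rightarrow> real) \<Rightarrow> 'a \<Rightarrow> 'a" where
  "gradient g x = (THE D. GDERIV g x :> D)"

definition unit_normal :: "(point \<Rightarrow> real) \<Rightarrow> point \<Rightarrow> point" where
  "unit_normal \<delta> x = gradient \<delta> x /\<^sub>R norm (gradient \<delta> x)"

text \<open>The regular zero level set \<open>\<Gamma>\<close> is automatically a surface without boundary, oriented by
  \<^const>\<open>unit_normal\<close>. Since the gradient does not vanish, \<open>\<delta>\<close> has opposite signs on the two sides
  of \<open>\<Gamma>\<close>.\<close>

definition signed_distance_surface :: "point set \<Rightarrow> point set \<Rightarrow> (point \<Rightarrow> real) \<Rightarrow> bool" where
  "signed_distance_surface \<Gamma> W \<delta> \<longleftrightarrow>
     compact \<Gamma> \<and> open W \<and> \<Gamma> = {x \<in> W. \<delta> x = 0} \<and>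
     Ck_on 2 \<delta> W \<and> (\<forall>x\<in>W. \<bar>\<delta> x\<bar> = infdist x \<Gamma>) \<and> (\<forall>x\<in>W. gradient \<delta> x \<noteq> 0) \<and>
     (\<forall>x\<in>W. \<exists>!y. y \<in> \<Gamma> \<and> x = y + \<delta> x *\<^sub>R unit_normal \<delta> y)"

definition surface_projection :: "point set \<Rightarrow> (point \<Rightarrow> real) \<Rightarrow> point \<Rightarrow> point" where
  "surface_projection \<Gamma> \<delta> x = (THE y. y \<in> \<Gamma> \<and> x = y + \<delta> x *\<^sub>R unit_normal \<delta> y)"

section \<open>Triangulated surfaces\<close>

definition vertices :: "point set set \<Rightarrow> point set" where
  "vertices \<K> = {x. \<exists>K\<in>\<K>. x extreme_point_of K}"

text \<open>The library predicate \<^const>\<open>triangulation\<close> contains finiteness and conformity (two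
  triangles meet in a common, possibly empty, face). The surface \<open>\<Union>\<K>\<close> is closed: every edge
  belongs to exactly two triangles.\<close>

definition triangulated_surface ::
    "real \<Rightarrow> point set set \<Rightarrow> point set \<Rightarrow> point set \<Rightarrow> (point \<Rightarrow> real) \<Rightarrow> bool" where
  "triangulated_surface h \<K> \<Gamma> W \<delta> \<longleftrightarrow>
     triangulation \<K> \<and> (\<forall>K\<in>\<K>. 2 simplex K \<and> diameter K \<le> h) \<and>
     (\<forall>K\<in>\<K>. \<forall>e. e edge_of K \<longrightarrow> card {L\<in>\<K>. e edge_of L} = 2) \<and>
     vertices \<K> \<subseteq> \<Gamma> \<and> \<Union>\<K> \<subseteq> W \<and> bij_betw (surface_projection \<Gamma> \<delta>) (\<Union>\<K>) \<Gamma>"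

definition angle_at :: "'a::real_inner \<Rightarrow> 'a \<Rightarrow> 'a \<Rightarrow> real" where
  "angle_at s p q = arccos (((p - s) \<bullet> (q - s)) / (norm (p - s) * norm (q - s)))"

text \<open>Here \<open>p\<close>, \<open>q\<close> are the endpoints of the common edge of \<open>K1\<close> and \<open>K2\<close>, and \<open>s1\<close>, \<open>s2\<close> are
  the vertices opposite to it.\<close>

definition angle_condition :: "point set set \<Rightarrow> bool" where
  "angle_condition \<K> \<longleftrightarrow>
     (\<forall>K1\<in>\<K>. \<forall>K2\<in>\<K>. \<forall>p q s1 s2.
        K1 \<noteq> K2 \<and> K1 = convex hull {p, q, s1} \<and> K2 = convex hull {p, q, s2} \<longrightarrow>
        angle_at s1 p q + angle_at s2 p q \<le> pi)"

section \<open>Integration and differentiation on a triangulated surface\<close>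

text \<open>Area integral over a triangle by pulling back to the reference triangle; the norm of the cross
  product is the (constant) area element of the affine parametrisation. The value does not depend
  on the chosen order of the vertices.\<close>

definition triangle_integral :: "point set \<Rightarrow> (point \<Rightarrow> real) \<Rightarrow> real" where
  "triangle_integral K g =
     (let (p, q, s) = (SOME (p, q, s). K = convex hull {p, q, s})
      in norm (cross3 (q - p) (s - p)) *
         (LINT z:{z::real\<times>real. 0 \<le> fst z \<and> 0 \<le> snd z \<and> fst z + snd z \<le> 1}|lborel.
            g (p + fst z *\<^sub>R (q - p) + snd z *\<^sub>R (s - p))))"

text \<open>The integrand may depend on the triangle, as it does for products of trianglewise gradients.
  The overlaps of the triangles are null sets for the surface measure.\<close>

definition surface_integral :: "point set set \<Rightarrow> (point set \<Rightarrow> point \<Rightarrow> real) \<Rightarrow> real" where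
  "surface_integral \<K> g = (\<Sum>K\<in>\<K>. triangle_integral K (g K))"

text \<open>The tangential gradient of \<open>v\<close> on the flat piece \<open>K\<close>: the vector in the direction space of \<open>K\<close>
  that represents the derivative of \<open>v\<close> along \<open>K\<close>.\<close>

definition tangential_gradient :: "point set \<Rightarrow> (point \<Rightarrow> real) \<Rightarrow> point \<Rightarrow> point" where
  "tangential_gradient K v x =
     (THE g. g \<in> span {y - z |y z. y \<in> K \<and> z \<in> K} \<and>
             (v has_derivative (\<lambda>h. g \<bullet> h)) (at x within K))"

section \<open>Linear finite elements\<close>

text \<open>Functions on \<open>\<Union>\<K>\<close> are represented by their extension by zero, so that equality of
  functions on \<open>\<Union>\<K>\<close> is equality in the function type.\<close>

definition fe_space :: "point set set \<Rightarrow> (point \<Rightarrow> real) set" where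
  "fe_space \<K> = {v. continuous_on (\<Union>\<K>) v \<and>
                    (\<forall>K\<in>\<K>. \<exists>g c. \<forall>x\<in>K. v x = g \<bullet> x + c) \<and>
                    (\<forall>x. x \<notin> \<Union>\<K> \<longrightarrow> v x = 0)}"

definition nodal_basis :: "point set set \<Rightarrow> point \<Rightarrow> point \<Rightarrow> real" where
  "nodal_basis \<K> p =
     (THE \<xi>. \<xi> \<in> fe_space \<K> \<and> (\<forall>q\<in>vertices \<K>. \<xi> q = (if q = p then 1 else 0)))"

definition nodal_interpolant :: "point set set \<Rightarrow> (point \<Rightarrow> real) \<Rightarrow> point \<Rightarrow> real" where
  "nodal_interpolant \<K> v x = (\<Sum>p\<in>vertices \<K>. v p * nodal_basis \<K> p x)"

section \<open>The semi-discrete problem\<close>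

text \<open>The Bochner space of square integrable functions on \<open>[0,T]\<close> with values in \<^const>\<open>fe_space\<close>,
  for the maximum norm. As \<^const>\<open>fe_space\<close> is finite-dimensional, all norms give the same
  space and (strong) measurability is measurability of all point evaluations.\<close>

definition L2_fe :: "point set set \<Rightarrow> real \<Rightarrow> (real \<Rightarrow> point \<Rightarrow> real) \<Rightarrow> bool" where
  "L2_fe \<K> T v \<longleftrightarrow>
     (\<forall>t\<in>{0..T}. v t \<in> fe_space \<K>) \<and>
     (\<forall>x\<in>\<Union>\<K>. (\<lambda>t. v t x) \<in> borel_measurable (lebesgue_on {0..T})) \<and>
     integrable (lebesgue_on {0..T}) (\<lambda>t. (SUP x\<in>\<Union>\<K>. \<bar>v t x\<bar>)\<^sup>2)"

text \<open>Weak derivative on \<open>(0,T)\<close>, tested with continuously differentiable \<open>\<psi>\<close> of compact support.\<close>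

definition has_weak_derivative :: "real \<Rightarrow> (real \<Rightarrow> real) \<Rightarrow> (real \<Rightarrow> real) \<Rightarrow> bool" where
  "has_weak_derivative T u u' \<longleftrightarrow>
     (\<forall>\<psi> \<psi>'. (\<forall>t. (\<psi> has_real_derivative \<psi>' t) (at t)) \<and> continuous_on UNIV \<psi>' \<and>
        (\<exists>a b. 0 < a \<and> b < T \<and> (\<forall>t. t \<notin> {a..b} \<longrightarrow> \<psi> t = 0)) \<longrightarrow>
        integral\<^sup>L (lebesgue_on {0..T}) (\<lambda>t. u t * \<psi>' t) =
        - integral\<^sup>L (lebesgue_on {0..T}) (\<lambda>t. u' t * \<psi> t))"

text \<open>\<open>U t x $ k\<close> is the \<open>k\<close>-th component at time \<open>t\<close> and point \<open>x\<close>, and \<open>V\<close> is the time derivative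
  of \<open>U\<close>. Point values in time, in particular the initial value, refer to the continuous
  representative of the Sobolev function \<open>U\<close>, hence the continuity clause.\<close>

definition semidiscrete_solution ::
    "point set set \<Rightarrow> ('r::finite \<Rightarrow> real) \<Rightarrow> (real^'r \<Rightarrow> real^'r) \<Rightarrow> real \<Rightarrow>
     (real \<Rightarrow> point \<Rightarrow> real^'r) \<Rightarrow> bool" where
  "semidiscrete_solution \<K> d f T U \<longleftrightarrow>
     (\<exists>V. \<forall>k.
        L2_fe \<K> T (\<lambda>t x. U t x $ k) \<and> L2_fe \<K> T (\<lambda>t x. V t x $ k) \<and>
        (\<forall>x\<in>\<Union>\<K>. continuous_on {0..T} (\<lambda>t. U t x $ k) \<and>
                  has_weak_derivative T (\<lambda>t. U t x $ k) (\<lambda>t. V t x $ k)) \<and>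
        (\<forall>\<phi>\<in>fe_space \<K>. AE t in lebesgue_on {0..T}.
           surface_integral \<K> (\<lambda>K. nodal_interpolant \<K> (\<lambda>x. V t x $ k * \<phi> x))
           + d k * surface_integral \<K> (\<lambda>K x.
               tangential_gradient K (\<lambda>y. U t y $ k) x \<bullet> tangential_gradient K \<phi> x)
           = surface_integral \<K> (\<lambda>K. nodal_interpolant \<K> (\<lambda>x. f (U t x) $ k * \<phi> x))))"

definition unique_semidiscrete_solution ::
    "point set set \<Rightarrow> ('r::finite \<Rightarrow> real) \<Rightarrow> (real^'r \<Rightarrow> real^'r) \<Rightarrow> real \<Rightarrow>
     (real \<Rightarrow> point \<Rightarrow> real^'r) \<Rightarrow> bool" where
  "unique_semidiscrete_solution \<K> d f T U \<longleftrightarrow>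
     semidiscrete_solution \<K> d f T U \<and>
     (\<forall>U'. semidiscrete_solution \<K> d f T U' \<and> (\<forall>x\<in>\<Union>\<K>. U' 0 x = U 0 x) \<longrightarrow>
        (\<forall>t\<in>{0..T}. \<forall>x\<in>\<Union>\<K>. U' t x = U t x))"

definition invariant_region ::
    "point set set \<Rightarrow> ('r::finite \<Rightarrow> real) \<Rightarrow> (real^'r \<Rightarrow> real^'r) \<Rightarrow> (real^'r) set \<Rightarrow> bool" where
  "invariant_region \<K> d f \<Sigma> \<longleftrightarrow>
     (\<forall>T>0. \<forall>U. unique_semidiscrete_solution \<K> d f T U \<and> (\<forall>x\<in>\<Union>\<K>. U 0 x \<in> \<Sigma>) \<longrightarrow>
        (\<forall>t\<in>{0..T}. \<forall>x\<in>\<Union>\<K>. U t x \<in> \<Sigma>))"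

section \<open>Hyper-rectangles\<close>

definition hyper_rectangle :: "('r::finite \<Rightarrow> ereal) \<Rightarrow> ('r \<Rightarrow> ereal) \<Rightarrow> (real^'r) set" where
  "hyper_rectangle m M = {u. \<forall>k. m k \<le> ereal (u $ k) \<and> ereal (u $ k) \<le> M k}"

text \<open>The outward unit normals at \<open>u\<close> of all faces of the hyper-rectangle that contain \<open>u\<close>; an
  infinite bound contributes no face.\<close>

definition outward_normals ::
    "('r::finite \<Rightarrow> ereal) \<Rightarrow> ('r \<Rightarrow> ereal) \<Rightarrow> real^'r \<Rightarrow> (real^'r) set" where
  "outward_normals m M u =
     {axis k 1 |k. ereal (u $ k) = M k} \<union> {- axis k 1 |k. ereal (u $ k) = m k}"

end

theory Submission
  imports Defs
begin

text \<open>
  Testing the semi-discrete problem with the nodal basis function of a vertex \<open>p\<close> turns it, thanks to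
  mass lumping, into the ordinary differential equation
  \<open>m\<^sub>p U'\<^sub>k(p) + d\<^sub>k (\<Sum>q. (U\<^sub>k(q) - U\<^sub>k(p)) a\<^sub>q\<^sub>p) = m\<^sub>p f\<^sub>k(U(p))\<close> with the lumped mass \<open>m\<^sub>p > 0\<close> and
  the stiffness matrix \<open>a\<close>; writing differences instead of values is possible because the nodal basis
  sums to one, so that the rows of \<open>a\<close> sum to zero. For an edge \<open>pq\<close> the entry \<open>a\<^sub>q\<^sub>p\<close> is a
  negative multiple of the sum of the cotangents of the two angles opposite to the edge, and the
  angle condition makes that sum nonnegative (lemma \<open>stiffness_nonpos\<close>).

  Hence if all nodal values lie in the hyper-rectangle at a time \<open>t\<close> and \<open>U\<^sub>k(p)\<close> sits at its upper
  bound \<open>M\<^sub>k\<close>, then every difference \<open>U\<^sub>k(q) - U\<^sub>k(p)\<close> is nonpositive, so that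
  diffusion does not push \<open>U\<^sub>k(p)\<close> upwards, while the reaction strictly decreases it by the flux
  condition. Thus
  \<open>U\<^sub>k(p)\<close> does not exceed \<open>M\<^sub>k\<close> shortly after \<open>t\<close> (lemma \<open>eventually_below_barrier\<close>); the lower bounds
  are symmetric. The finitely many constraints that are not attained persist by continuity, so the
  closed set of times up to which the solution is inside can always be prolonged to the right and is
  all of \<open>[0,T]\<close>. Between the vertices the solution is piecewise affine and so takes no values beyond
  the nodal ones.

  Two technical points carry the rest of the text. The time derivative is only a weak one, so its sign
  is turned into monotonicity by testing with a smoothed indicator function of an interval
  (lemma \<open>weak_derivative_nonpos_imp_antimono\<close>). And the nodal basis and the trianglewise gradients
  are given by descriptions, the integrals by an arbitrary choice of a parametrisation, so that
  existence, uniqueness and independence of the choice have to be established first; conformity of the triangulation enters through the fact that two affine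
  pieces with the same vertex values agree on the common face (lemma \<open>affine_pieces_agree\<close>).
\<close>

section \<open>Sign of a weak derivative and continuation in time\<close>

lemma has_real_derivative_square_pos_part:
  fixes x :: real
  shows "((\<lambda>t. (max 0 t)\<^sup>2) has_real_derivative 2 * max 0 x) (at x)"
proof -
  consider "x < 0" | "x = 0" | "x > 0" by linarith
  then show ?thesis
  proof cases
    case 1
    have "((\<lambda>t. 0) has_real_derivative 0) (at x)" by simp
    then have "((\<lambda>t. (max 0 t)\<^sup>2) has_real_derivative 0) (at x)"
      by (rule has_field_derivative_transform_within_open[where S="{..<0}"]) (use 1 in auto)
    then show ?thesis using 1 by simp
  next
    case 3
    have "((\<lambda>t. t\<^sup>2) has_real_derivative 2 * x) (at x)" by (auto intro!: derivative_eq_intros)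
    then have "((\<lambda>t. (max 0 t)\<^sup>2) has_real_derivative 2 * x) (at x)"
      by (rule has_field_derivative_transform_within_open[where S="{0<..}"]) (use 3 in auto)
    then show ?thesis using 3 by simp
  next
    case 2
    have "((\<lambda>h. (max 0 h)\<^sup>2 / h) \<longlongrightarrow> (0::real)) (at 0)"
    proof (rule Lim_null_comparison)
      show "eventually (\<lambda>h. norm ((max 0 h)\<^sup>2 / h) \<le> \<bar>h\<bar>) (at (0::real))"
        by (intro always_eventually allI) (auto simp: max_def power2_eq_square)
      show "((\<lambda>h. \<bar>h\<bar>) \<longlongrightarrow> 0) (at (0::real))"
        by (rule tendsto_eq_intros refl | simp)+
    qed
    then show ?thesis using 2 by (simp add: DERIV_def)
  qed
qed

text \<open>The second difference of \<open>x \<mapsto> (max 0 x)\<^sup>2 / 2\<close> is a continuously differentiable transition from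
  0 to 1; its derivative is the piecewise linear tent on \<open>[0,2]\<close>. Truncated powers avoid all gluing of
  pieces when differentiating.\<close>

definition tent :: "real \<Rightarrow> real" where
  "tent x = max 0 x - 2 * max 0 (x - 1) + max 0 (x - 2)"

definition smooth_step :: "real \<Rightarrow> real" where
  "smooth_step x = ((max 0 x)\<^sup>2 - 2 * (max 0 (x - 1))\<^sup>2 + (max 0 (x - 2))\<^sup>2) / 2"

lemma DERIV_smooth_step: "(smooth_step has_real_derivative tent x) (at x)"
proof -
  have shift: "((\<lambda>t. (max 0 (t - c))\<^sup>2) has_real_derivative 2 * max 0 (x - c)) (at x)" for c
    using DERIV_chain2[where f="\<lambda>t. (max 0 t)\<^sup>2" and s=UNIV and x=x and g="\<lambda>t. t - c" and Db=1,
        OF has_real_derivative_square_pos_part]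
    by (force intro: derivative_eq_intros)
  show ?thesis
    unfolding smooth_step_def[abs_def] tent_def
    by (rule derivative_eq_intros shift shift[of 0, simplified] refl | simp)+
qed

lemma DERIV_smooth_step_rescaled:
  "r \<noteq> 0 \<Longrightarrow> ((\<lambda>t. smooth_step ((t - c) / r)) has_real_derivative tent ((t - c) / r) / r) (at t)"
  using DERIV_chain2[where f=smooth_step and s=UNIV and x=t and g="\<lambda>t. (t - c) / r" and Db="1 / r",
      OF DERIV_smooth_step]
  by (force intro: derivative_eq_intros)

lemma tent_nonneg: "tent x \<ge> 0"
  by (auto simp: tent_def max_def)

lemma tent_eq_0: "x \<le> 0 \<or> 2 \<le> x \<Longrightarrow> tent x = 0"
  by (auto simp: tent_def max_def)

lemma smooth_step_eq_0: "x \<le> 0 \<Longrightarrow> smooth_step x = 0"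
  by (simp add: smooth_step_def)

lemma smooth_step_eq_1: "2 \<le> x \<Longrightarrow> smooth_step x = 1"
  by (simp add: smooth_step_def power2_eq_square algebra_simps)

lemma smooth_step_mono: "x \<le> y \<Longrightarrow> smooth_step x \<le> smooth_step y"
  by (rule DERIV_nonneg_imp_nondecreasing) (use DERIV_smooth_step tent_nonneg in blast)+

lemma continuous_on_tent [continuous_intros]: "continuous_on S tent"
  unfolding tent_def[abs_def] by (intro continuous_intros)

lemma integral_tent:
  fixes a r T :: real
  assumes "0 < r" "0 \<le> a" "a + 2 * r \<le> T"
  shows "integral\<^sup>L (lebesgue_on {0..T}) (\<lambda>t. tent ((t - a) / r) / r) = 1"
    and "integrable (lebesgue_on {0..T}) (\<lambda>t. tent ((t - a) / r) / r)"
proof -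
  have D: "((\<lambda>t. smooth_step ((t - a) / r)) has_real_derivative tent ((t - a) / r) / r) (at t)" for t
    using assms by (intro DERIV_smooth_step_rescaled) simp
  have "((\<lambda>t. tent ((t - a) / r) / r) has_integral
      (smooth_step ((T - a) / r) - smooth_step ((0 - a) / r))) {0..T}"
    by (rule fundamental_theorem_of_calculus)
      (use assms D in \<open>auto intro!: has_real_derivative_iff_has_vector_derivative[THEN iffD1]
         intro: has_field_derivative_at_within\<close>)
  moreover have "smooth_step ((T - a) / r) = 1" "smooth_step ((0 - a) / r) = 0"
    using assms by (auto intro!: smooth_step_eq_1 smooth_step_eq_0 simp: field_simps)
  ultimately have I: "integral {0..T} (\<lambda>t. tent ((t - a) / r) / r) = 1"
    by (metis integral_unique diff_zero)
  show *: "integrable (lebesgue_on {0..T}) (\<lambda>t. tent ((t - a) / r) / r)"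
    by (intro continuous_imp_integrable_real continuous_intros continuous_on_compose2[OF continuous_on_tent[of UNIV]])
      (use assms in auto)
  show "integral\<^sup>L (lebesgue_on {0..T}) (\<lambda>t. tent ((t - a) / r) / r) = 1"
    unfolding I[symmetric] by (rule lebesgue_integral_eq_integral[OF *]) simp
qed

text \<open>The test function rises from 0 to 1 just after \<open>a\<close> and falls back to 0 just after \<open>b\<close>. Pairing its
  derivative with \<open>u\<close> gives the difference of a local average of \<open>u\<close> near \<open>a\<close> and one near \<open>b\<close>, and
  the weak equation says that this difference is nonnegative. If \<open>u b > u a\<close>, the averages over
  short enough intervals contradict this by continuity.\<close>

lemma weak_derivative_nonpos_imp_antimono:
  fixes u v :: "real \<Rightarrow> real"
  assumes cont: "continuous_on {0..T} u" and weak: "has_weak_derivative T u v"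
    and nonpos: "AE t in lebesgue_on {0..T}. t \<in> {t0..t1} \<longrightarrow> v t \<le> 0"
    and ord: "0 \<le> t0" "t0 < a" "a < b" "b < t1" "t1 \<le> T"
  shows "u b \<le> u a"
proof (rule ccontr)
  assume "\<not> u b \<le> u a"
  \<comment> \<open>A third of the jump leaves a gap between the values near \<open>a\<close> and the values near \<open>b\<close>.\<close>
  define e where "e = (u b - u a) / 3"
  have "e > 0" using \<open>\<not> u b \<le> u a\<close> by (simp add: e_def)
  have ab: "a \<in> {0..T}" "b \<in> {0..T}" using ord by auto
  obtain ra where ra: "ra > 0" "\<And>t. t \<in> {0..T} \<Longrightarrow> \<bar>t - a\<bar> < ra \<Longrightarrow> \<bar>u t - u a\<bar> < e"
    using cont[unfolded continuous_on_iff, rule_format, OF ab(1) \<open>e > 0\<close>]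
    by (auto simp: dist_real_def)
  obtain rb where rb: "rb > 0" "\<And>t. t \<in> {0..T} \<Longrightarrow> \<bar>t - b\<bar> < rb \<Longrightarrow> \<bar>u t - u b\<bar> < e"
    using cont[unfolded continuous_on_iff, rule_format, OF ab(2) \<open>e > 0\<close>]
    by (auto simp: dist_real_def)
  \<comment> \<open>The transitions have length \<open>2 * r\<close>: they must be disjoint, end before \<open>t1\<close>, and stay where
    \<open>u\<close> is close to \<open>u a\<close> and \<open>u b\<close>.\<close>
  define r where "r = min (min ra rb) (min (b - a) (t1 - b)) / 4"
  have r: "r > 0" "2 * r < ra" "2 * r < rb" "2 * r < b - a" "2 * r < t1 - b"
    using ra(1) rb(1) ord by (auto simp: r_def)
  define A where "A = (\<lambda>t. tent ((t - a) / r) / r)"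
  define B where "B = (\<lambda>t. tent ((t - b) / r) / r)"
  define \<psi> where "\<psi> = (\<lambda>t. smooth_step ((t - a) / r) - smooth_step ((t - b) / r))"
  have D: "((\<lambda>t. smooth_step ((t - c) / r)) has_real_derivative tent ((t - c) / r) / r) (at t)" for t c
    using r by (intro DERIV_smooth_step_rescaled) simp
  have D\<psi>: "(\<psi> has_real_derivative A t - B t) (at t)" for t
    unfolding \<psi>_def A_def B_def by (intro DERIV_diff D)
  have contAB: "continuous_on S A" "continuous_on S B" for S
    unfolding A_def B_def
    by (intro continuous_intros continuous_on_compose2[OF continuous_on_tent[of UNIV]]; use r in auto)+
  have supp: "\<psi> t = 0" if "t \<notin> {a..b + 2 * r}" for t
  proof (cases "t < a")
    case True
    then have "(t - a) / r \<le> 0" "(t - b) / r \<le> 0" using r ord by (auto simp: field_simps)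
    then show ?thesis by (simp add: \<psi>_def smooth_step_eq_0)
  next
    case False
    then have "t > b + 2 * r" using that by auto
    then have "(t - a) / r \<ge> 2" "(t - b) / r \<ge> 2" using r ord by (auto simp: field_simps)
    then show ?thesis by (simp add: \<psi>_def smooth_step_eq_1)
  qed
  have \<psi>_nonneg: "\<psi> t \<ge> 0" for t
    using smooth_step_mono[of "(t - b) / r" "(t - a) / r"] r ord
    by (simp add: \<psi>_def divide_right_mono)
  have eq: "integral\<^sup>L (lebesgue_on {0..T}) (\<lambda>t. u t * (A t - B t)) =
        - integral\<^sup>L (lebesgue_on {0..T}) (\<lambda>t. v t * \<psi> t)"
  proof (rule weak[unfolded has_weak_derivative_def, rule_format], intro conjI)
    show "\<forall>t. (\<psi> has_real_derivative A t - B t) (at t)" using D\<psi> by blast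
    show "continuous_on UNIV (\<lambda>t. A t - B t)" by (intro continuous_intros contAB)
    show "\<exists>a b. 0 < a \<and> b < T \<and> (\<forall>t. t \<notin> {a..b} \<longrightarrow> \<psi> t = 0)"
      using ord r supp by (intro exI[of _ a] exI[of _ "b + 2 * r"]) auto
  qed
  have "0 \<le> integral\<^sup>L (lebesgue_on {0..T}) (\<lambda>t. - (v t * \<psi> t))"
  proof (rule integral_nonneg_AE)
    show "AE t in lebesgue_on {0..T}. 0 \<le> - (v t * \<psi> t)"
      using nonpos
    proof eventually_elim
      case (elim t)
      show ?case
      proof (cases "t \<in> {a..b + 2 * r}")
        case True
        then have "v t \<le> 0" using elim ord r by auto
        then show ?thesis using \<psi>_nonneg[of t] by (simp add: mult_nonpos_nonneg)
      qed (simp add: supp)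
    qed
  qed
  then have "0 \<le> integral\<^sup>L (lebesgue_on {0..T}) (\<lambda>t. u t * (A t - B t))"
    using eq by simp
  also have "\<dots> \<le> integral\<^sup>L (lebesgue_on {0..T}) (\<lambda>t. (u a + e) * A t - (u b - e) * B t)"
  proof (rule integral_mono)
    show "integrable (lebesgue_on {0..T}) (\<lambda>t. u t * (A t - B t))"
      by (intro continuous_imp_integrable_real continuous_intros contAB cont)
    show "integrable (lebesgue_on {0..T}) (\<lambda>t. (u a + e) * A t - (u b - e) * B t)"
      by (intro continuous_imp_integrable_real continuous_intros contAB cont)
    fix t assume "t \<in> space (lebesgue_on {0..T})"
    then have t: "t \<in> {0..T}" by simp
    have AB: "A t \<ge> 0" "B t \<ge> 0" using r tent_nonneg by (auto simp: A_def B_def)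
    have "u t * A t \<le> (u a + e) * A t"
    proof (cases "t \<in> {a..a + 2 * r}")
      case True
      then have "u t \<le> u a + e" using ra(2)[OF t] r by auto
      then show ?thesis using AB by (intro mult_right_mono)
    next
      case False
      then have "(t - a) / r \<le> 0 \<or> 2 \<le> (t - a) / r" using r by (auto simp: field_simps)
      then show ?thesis by (simp add: A_def tent_eq_0)
    qed
    moreover have "(u b - e) * B t \<le> u t * B t"
    proof (cases "t \<in> {b..b + 2 * r}")
      case True
      then have "u b - e \<le> u t" using rb(2)[OF t] r by auto
      then show ?thesis using AB by (intro mult_right_mono)
    next
      case False
      then have "(t - b) / r \<le> 0 \<or> 2 \<le> (t - b) / r" using r by (auto simp: field_simps)
      then show ?thesis by (simp add: B_def tent_eq_0)
    qed
    ultimately show "u t * (A t - B t) \<le> (u a + e) * A t - (u b - e) * B t"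
      by (simp add: algebra_simps)
  qed
  also have "\<dots> = (u a + e) - (u b - e)"
  proof -
    have "integrable (lebesgue_on {0..T}) A" "integrable (lebesgue_on {0..T}) B"
      "integral\<^sup>L (lebesgue_on {0..T}) A = 1" "integral\<^sup>L (lebesgue_on {0..T}) B = 1"
      unfolding A_def B_def by (intro integral_tent; use r ord in simp)+
    then show ?thesis by simp
  qed
  also have "\<dots> < 0" using \<open>e > 0\<close> by (simp add: e_def field_simps)
  finally show False by simp
qed

text \<open>Continuity keeps \<open>g\<close> negative for a short time, where \<open>u\<close> is therefore nonincreasing. Test functions
  vanish near the ends of the interval of time, so the comparison with \<open>t0\<close> itself (which may be 0)
  comes from letting the left point tend to \<open>t0\<close>.\<close>

lemma weak_derivative_neg_imp_eventually_le:
  fixes u v g :: "real \<Rightarrow> real"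
  assumes cont: "continuous_on {0..T} u" and weak: "has_weak_derivative T u v"
    and v: "AE t in lebesgue_on {0..T}. v t = g t" and g: "continuous_on {0..T} g"
    and t0: "0 \<le> t0" "t0 < T" and neg: "g t0 < 0"
  shows "eventually (\<lambda>t. u t \<le> u t0) (at_right t0)"
proof -
  obtain r where r: "r > 0" "\<And>t. t \<in> {0..T} \<Longrightarrow> \<bar>t - t0\<bar> < r \<Longrightarrow> \<bar>g t - g t0\<bar> < - g t0"
    using g[unfolded continuous_on_iff, rule_format, of t0 "- g t0"] neg t0
    by (auto simp: dist_real_def)
  define t1 where "t1 = min T (t0 + r / 2)"
  have t1: "t0 < t1" "t1 \<le> T" "t1 < t0 + r" using t0 r(1) by (auto simp: t1_def)
  have nonpos: "AE t in lebesgue_on {0..T}. t \<in> {t0..t1} \<longrightarrow> v t \<le> 0"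
    using v
  proof eventually_elim
    case (elim t)
    show ?case
    proof
      assume "t \<in> {t0..t1}"
      then have "\<bar>g t - g t0\<bar> < - g t0" using t1 t0 by (intro r(2)) auto
      then show "v t \<le> 0" using elim by simp
    qed
  qed
  have "u b \<le> u t0" if b: "b \<in> {t0<..<t1}" for b
  proof (rule tendsto_lowerbound)
    have "(u \<longlongrightarrow> u t0) (at t0 within {0..T})"
      using cont t0 by (auto simp: continuous_on)
    moreover have "at t0 within {t0<..<b} \<le> at t0 within {0..T}"
      using b t1 t0 by (intro at_le) auto
    ultimately show "(u \<longlongrightarrow> u t0) (at t0 within {t0<..<b})"
      by (rule tendsto_mono[rotated])
    show "eventually (\<lambda>a. u b \<le> u a) (at t0 within {t0<..<b})"
      unfolding eventually_at_filter
      using weak_derivative_nonpos_imp_antimono[OF cont weak nonpos t0(1)] b t1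
      by (intro always_eventually) auto
    show "at t0 within {t0<..<b} \<noteq> bot"
      using b by (simp add: at_within_eq_bot_iff)
  qed
  moreover have "eventually (\<lambda>t. t \<in> {t0<..<t1}) (at_right t0)"
    using t1 by (rule_tac eventually_at_right_real)
  ultimately show ?thesis by (auto elim: eventually_mono)
qed

lemma has_weak_derivative_cmult:
  assumes "has_weak_derivative T u v"
  shows "has_weak_derivative T (\<lambda>t. c * u t) (\<lambda>t. c * v t)"
  unfolding has_weak_derivative_def
proof (intro allI impI)
  fix \<psi> \<psi>' :: "real \<Rightarrow> real"
  assume "(\<forall>t. (\<psi> has_real_derivative \<psi>' t) (at t)) \<and> continuous_on UNIV \<psi>' \<and>
    (\<exists>a b. 0 < a \<and> b < T \<and> (\<forall>t. t \<notin> {a..b} \<longrightarrow> \<psi> t = 0))"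
  from assms[unfolded has_weak_derivative_def, rule_format, OF this]
  show "integral\<^sup>L (lebesgue_on {0..T}) (\<lambda>t. c * u t * \<psi>' t) =
        - integral\<^sup>L (lebesgue_on {0..T}) (\<lambda>t. c * v t * \<psi> t)"
    unfolding mult.assoc[of c] integral_mult_right_zero by simp
qed

text \<open>Continuous induction: the supremum of the times up to which \<open>S\<close> has no gap belongs to \<open>S\<close> by
  closedness, and could be increased if it were less than \<open>T\<close>.\<close>

lemma real_interval_continuation:
  fixes S :: "real set"
  assumes "0 \<in> S" "closed S" and S: "S \<subseteq> {0..T}"
    and step: "\<And>t. t \<in> S \<Longrightarrow> t < T \<Longrightarrow> eventually (\<lambda>s. s \<in> S) (at_right t)"
  shows "{0..T} \<subseteq> S"
proof
  fix t1 assume t1: "t1 \<in> {0..T}"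
  define R where "R = {t \<in> {0..t1}. {0..t} \<subseteq> S}"
  have "0 \<in> R" using assms(1) t1 by (auto simp: R_def)
  have bdd: "bdd_above R" by (auto simp: R_def)
  define s where "s = Sup R"
  have "0 \<le> s"
    unfolding s_def by (rule cSup_upper[OF \<open>0 \<in> R\<close> bdd])
  moreover have "s \<le> t1"
    unfolding s_def by (rule cSup_least) (use \<open>0 \<in> R\<close> in \<open>auto simp: R_def\<close>)
  ultimately have s: "0 \<le> s" "s \<le> t1" by blast+
  have below: "t \<in> S" if t: "0 \<le> t" "t < s" for t
  proof -
    obtain x where "x \<in> R" "t < x"
      using less_cSupE[OF t(2)[unfolded s_def]] \<open>0 \<in> R\<close> by blast
    then show ?thesis using t by (simp add: R_def subset_iff)
  qed
  have "s \<in> S"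
  proof (cases "s = 0")
    case False
    then have "0 < s" using s by simp
    have "s \<in> closure {0..<s}" using \<open>0 < s\<close> by simp
    moreover have "closure {0..<s} \<subseteq> S" using below \<open>closed S\<close> by (intro closure_minimal) auto
    ultimately show ?thesis by blast
  qed (use assms(1) in simp)
  have "s = t1"
  proof (rule ccontr)
    assume "s \<noteq> t1"
    then have "s < t1" using s by simp
    then have "eventually (\<lambda>x. x \<in> S) (at_right s)" using step[OF \<open>s \<in> S\<close>] t1 by auto
    then obtain b where b: "b > s" "\<And>y. s < y \<Longrightarrow> y < b \<Longrightarrow> y \<in> S"
      unfolding eventually_at_right_field by blast
    define y where "y = min t1 ((s + b) / 2)"
    have y: "s < y" "y < b" "y \<le> t1" using b(1) \<open>s < t1\<close> by (auto simp: y_def min_def field_simps)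
    have "x \<in> S" if "0 \<le> x" "x \<le> y" for x
      using below[OF that(1)] \<open>s \<in> S\<close> b(2)[of x] that y(2)
      by (metis linorder_less_linear order_le_less_trans)
    then have "y \<in> R" using y s by (simp add: R_def subset_iff)
    then show False using cSup_upper[OF \<open>y \<in> R\<close> bdd] y(1) by (simp add: s_def)
  qed
  then show "t1 \<in> S" using \<open>s \<in> S\<close> by simp
qed

section \<open>Triangles, barycentric gradients and affine functions\<close>

text \<open>The Gram determinant of two edge vectors, that is, the square of twice the area of the triangle. Its
  invariance under permutations of the vertices makes the area independent of the
  parametrisation that the definition of the integral happens to choose.\<close>

definition gram :: "'a::real_inner \<Rightarrow> 'a \<Rightarrow> 'a \<Rightarrow> real" where
  "gram p q s = (norm (q - p))\<^sup>2 * (norm (s - p))\<^sup>2 - ((q - p) \<bullet> (s - p))\<^sup>2"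

lemma gram_swap: "gram p q s = gram p s q"
  by (simp add: gram_def inner_commute)

lemma gram_rotate: "gram p q s = gram q p s"
proof -
  define a b where "a = q - p" and "b = s - p"
  have *: "p - q = - a" "s - q = b - a" by (simp_all add: a_def b_def)
  show ?thesis
    unfolding gram_def * a_def[symmetric] b_def[symmetric] power2_norm_eq_inner
    unfolding power2_eq_square
    by (simp add: algebra_simps inner_commute)
qed

lemma gram_set_eq:
  assumes "{p, q, s} = {p', q', s'}" "\<not> collinear {p, q, s}"
  shows "gram p q s = gram p' q' s'"
proof -
  have ne: "p \<noteq> q" "q \<noteq> s" "p \<noteq> s" using assms(2) by (auto simp: insert_commute)
  have "card {p', q', s'} = 3" using ne assms(1)[symmetric] by simp
  then have ne': "p' \<noteq> q'" "q' \<noteq> s'" "p' \<noteq> s'" by (auto simp: card_insert_if split: if_splits)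
  have "p' \<in> {p, q, s}" "q' \<in> {p, q, s}" "s' \<in> {p, q, s}" unfolding assms(1) by blast+
  then have "p' = p \<and> q' = q \<and> s' = s \<or> p' = p \<and> q' = s \<and> s' = q \<or> p' = q \<and> q' = p \<and> s' = s \<or>
    p' = q \<and> q' = s \<and> s' = p \<or> p' = s \<and> q' = p \<and> s' = q \<or> p' = s \<and> q' = q \<and> s' = p"
    using ne' by blast
  moreover have "gram p s q = gram p q s" "gram q p s = gram p q s" "gram q s p = gram p q s"
    "gram s p q = gram p q s" "gram s q p = gram p q s"
    using gram_swap[of p s q] gram_rotate[of p q s] gram_swap[of q s p] gram_rotate[of s p q]
      gram_swap[of s q p] by simp_all
  ultimately show ?thesis by (elim disjE) simp_all
qed

lemma gram_pos:
  assumes "\<not> collinear {p, q, s}"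
  shows "gram p q s > 0"
proof -
  have "{q, p, s} = {p, q, s}" by auto
  then have "\<not> collinear {0, q - p, s - p}"
    using assms collinear_3[of q p s, unfolded NO_MATCH_def] by simp
  then have "\<bar>(q - p) \<bullet> (s - p)\<bar> \<noteq> norm (q - p) * norm (s - p)"
    by (simp add: norm_cauchy_schwarz_equal)
  then have "\<bar>(q - p) \<bullet> (s - p)\<bar> < norm (q - p) * norm (s - p)"
    using Cauchy_Schwarz_ineq2[of "q - p" "s - p"] by simp
  then have "\<bar>(q - p) \<bullet> (s - p)\<bar>\<^sup>2 < (norm (q - p) * norm (s - p))\<^sup>2"
    by (intro power_strict_mono) auto
  then show ?thesis by (simp add: gram_def power_mult_distrib)
qed

text \<open>The gradient of the barycentric coordinate of \<open>p\<close> in the triangle \<open>pqs\<close>: the component of \<open>p - s\<close>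
  orthogonal to \<open>q - s\<close>, scaled to have inner product 1 with \<open>p - s\<close>.\<close>

definition bary_gradient :: "'a::real_inner \<Rightarrow> 'a \<Rightarrow> 'a \<Rightarrow> 'a" where
  "bary_gradient p q s =
     ((norm (q - s))\<^sup>2 *\<^sub>R (p - s) - ((p - s) \<bullet> (q - s)) *\<^sub>R (q - s)) /\<^sub>R gram s p q"

lemma inner_bary_gradient:
  "w \<bullet> bary_gradient p q s =
     ((norm (q - s))\<^sup>2 * (w \<bullet> (p - s)) - ((p - s) \<bullet> (q - s)) * (w \<bullet> (q - s))) / gram s p q"
  unfolding bary_gradient_def inner_scaleR_right inner_diff_right[of w "_ *\<^sub>R _"]
  by (simp only: divide_inverse mult.commute)

lemma bary_gradient_inner:
  assumes "\<not> collinear {p, q, s}"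
  shows "(p - s) \<bullet> bary_gradient p q s = 1" "(q - s) \<bullet> bary_gradient p q s = 0"
proof -
  have "gram s p q > 0" using assms by (intro gram_pos) (simp add: insert_commute)
  moreover have "gram s p q = (norm (q - s))\<^sup>2 * ((p - s) \<bullet> (p - s)) - ((p - s) \<bullet> (q - s)) * ((p - s) \<bullet> (q - s))"
    unfolding gram_def power2_norm_eq_inner unfolding power2_eq_square by (simp only: mult.commute)
  ultimately show "(p - s) \<bullet> bary_gradient p q s = 1"
    unfolding inner_bary_gradient by simp
  show "(q - s) \<bullet> bary_gradient p q s = 0"
    unfolding inner_bary_gradient power2_norm_eq_inner by (simp only: inner_commute) simp
qed

text \<open>Multiplied by the area of the triangle, the right-hand side is minus half the cotangent of the angle
  at \<open>s\<close>.\<close>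

lemma bary_gradient_inner_bary_gradient:
  assumes "\<not> collinear {p, q, s}"
  shows "bary_gradient p q s \<bullet> bary_gradient q p s = - ((p - s) \<bullet> (q - s)) / gram s p q"
  unfolding inner_bary_gradient[of "bary_gradient p q s" q p s]
  by (simp only: inner_commute[of "bary_gradient p q s"] bary_gradient_inner[OF assms]
      gram_swap[of s q p] inner_commute[of "q - s" "p - s"]) simp

lemma bary_gradient_in_span:
  assumes "p \<in> K" "q \<in> K" "s \<in> K"
  shows "bary_gradient p q s \<in> span {y - z |y z. y \<in> K \<and> z \<in> K}"
proof -
  have "p - s \<in> {y - z |y z. y \<in> K \<and> z \<in> K}" "q - s \<in> {y - z |y z. y \<in> K \<and> z \<in> K}"
    using assms by blast+
  then show ?thesis
    unfolding bary_gradient_def by (intro span_scale span_diff[of "_ *\<^sub>R _"] span_base)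
qed

lemma affine_eq_on_convex_hull:
  fixes g g' :: "'a::real_inner"
  assumes "\<And>x. x \<in> S \<Longrightarrow> g \<bullet> x + c = g' \<bullet> x + c'" "x \<in> convex hull S"
  shows "g \<bullet> x + c = g' \<bullet> x + c'"
proof -
  have "convex hull S \<subseteq> {x. (g - g') \<bullet> x = c' - c}"
    by (rule hull_minimal) (use assms(1) in \<open>force simp: inner_diff_left\<close>, rule convex_hyperplane)
  then show ?thesis using assms(2) by (auto simp: inner_diff_left algebra_simps)
qed

text \<open>Uniqueness is the issue, as derivatives within a flat set are not unique among all linear maps:
  along a segment from \<open>x\<close> to another point of \<open>K\<close> the derivative is determined, so two candidates
  differ by a vector orthogonal to the direction space of \<open>K\<close> that also belongs to it.\<close>

lemma tangential_gradient_eqI: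
  assumes K: "convex K" "x \<in> K"
    and G: "G \<in> span {y - z |y z. y \<in> K \<and> z \<in> K}"
    and v: "\<And>y. y \<in> K \<Longrightarrow> v y = G \<bullet> y + c"
  shows "tangential_gradient K v x = G"
  unfolding tangential_gradient_def
proof (rule the_equality, intro conjI G)
  have "((\<lambda>y. G \<bullet> y + c) has_derivative (\<lambda>h. G \<bullet> h)) (at x within K)"
    by (auto intro!: derivative_eq_intros)
  then show "(v has_derivative (\<lambda>h. G \<bullet> h)) (at x within K)"
    by (rule has_derivative_transform[OF K(2), rotated]) (use v in auto)
next
  fix g assume g: "g \<in> span {y - z |y z. y \<in> K \<and> z \<in> K} \<and> (v has_derivative (\<lambda>h. g \<bullet> h)) (at x within K)"
  have dir: "g \<bullet> (y - x) = G \<bullet> (y - x)" if y: "y \<in> K" for y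
  proof -
    define l where "l = (\<lambda>t::real. x + t *\<^sub>R (y - x))"
    have l: "l ` cbox 0 1 \<subseteq> K"
    proof
      fix z assume "z \<in> l ` cbox 0 1"
      then obtain t where t: "0 \<le> t" "t \<le> 1" "z = (1 - t) *\<^sub>R x + t *\<^sub>R y"
        by (auto simp: l_def algebra_simps)
      then show "z \<in> K" using convexD_alt[OF K(1) K(2) y] by simp
    qed
    have l0: "l 0 = x" by (simp add: l_def)
    have "(l has_derivative (\<lambda>t. t *\<^sub>R (y - x))) (at 0 within cbox 0 1)"
      unfolding l_def by (auto intro!: derivative_eq_intros)
    moreover have "(v has_derivative (\<lambda>h. g \<bullet> h)) (at (l 0) within l ` cbox 0 1)"
      unfolding l0 using g l by (blast intro: has_derivative_subset)
    ultimately have "(v \<circ> l has_derivative (\<lambda>h. g \<bullet> h) \<circ> (\<lambda>t. t *\<^sub>R (y - x))) (at 0 within cbox 0 1)"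
      by (rule diff_chain_within)
    then have 1: "(v \<circ> l has_vector_derivative g \<bullet> (y - x)) (at 0 within cbox 0 1)"
      by (simp add: has_vector_derivative_def o_def)
    have "((\<lambda>t. G \<bullet> x + c + t * (G \<bullet> (y - x))) has_vector_derivative G \<bullet> (y - x)) (at 0 within cbox 0 1)"
      by (auto intro!: derivative_eq_intros simp: has_vector_derivative_def)
    then have 2: "(v \<circ> l has_vector_derivative G \<bullet> (y - x)) (at 0 within cbox 0 1)"
    proof (rule has_vector_derivative_transform[rotated 2])
      fix t :: real assume "t \<in> cbox 0 1"
      then have "l t \<in> K" using l by auto
      then show "(v \<circ> l) t = G \<bullet> x + c + t * (G \<bullet> (y - x))"
        by (simp add: v) (simp add: l_def inner_right_distrib)
    qed simp
    show ?thesis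
      by (rule vector_derivative_unique_within_closed_interval[OF _ _ 1 2]) auto
  qed
  have "orthogonal (g - G) w" if "w \<in> span {y - z |y z. y \<in> K \<and> z \<in> K}" for w
  proof (rule orthogonal_to_span[OF that])
    fix w assume "w \<in> {y - z |y z. y \<in> K \<and> z \<in> K}"
    then obtain y z where "y \<in> K" "z \<in> K" "w = (y - x) - (z - x)" by auto
    then show "orthogonal (g - G) w"
      using dir[of y] dir[of z] unfolding orthogonal_def
      by (simp only: inner_diff_left inner_diff_right) simp
  qed
  then have "orthogonal (g - G) (g - G)" using g G by (blast intro: span_diff)
  then show "g = G" by (simp add: orthogonal_def)
qed

lemma simplex_2_obtain:
  assumes "2 simplex K"
  obtains p q s where "K = convex hull {p, q, s}" "\<not> collinear {p, q, s}"
proof -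
  obtain C where C: "\<not> affine_dependent C" "card C = 3" "K = convex hull C"
    using assms by (auto simp: simplex_def)
  then obtain p q s where pqs: "C = {p, q, s}" "p \<noteq> q" "q \<noteq> s" "p \<noteq> s"
    by (auto simp: card_3_iff)
  then show ?thesis
    using that[of p q s] C by (auto simp: collinear_3_eq_affine_dependent)
qed

lemma simplex_2_hull_not_collinear:
  assumes "2 simplex K" "K = convex hull {p, q, s}"
  shows "\<not> collinear {p, q, s}"
proof
  assume "collinear {p, q, s}"
  then have "aff_dim {p, q, s} \<le> 1" by (simp add: collinear_aff_dim)
  moreover have "aff_dim K = 2" using aff_dim_simplex[OF assms(1)] by simp
  ultimately show False using assms(2) by (simp add: aff_dim_convex_hull)
qed

lemma extreme_point_of_triangle:
  fixes p q s :: "'a::euclidean_space"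
  assumes "\<not> collinear {p, q, s}"
  shows "x extreme_point_of (convex hull {p, q, s}) \<longleftrightarrow> x \<in> {p, q, s}"
  by (rule extreme_point_of_convex_hull_affine_independent)
    (use assms in \<open>auto simp: collinear_3_eq_affine_dependent\<close>)

lemma simplex_2_two_vertices:
  assumes "2 simplex K" "p extreme_point_of K" "q extreme_point_of K" "p \<noteq> q"
  obtains s where "K = convex hull {p, q, s}" "\<not> collinear {p, q, s}"
proof -
  obtain a b c where abc: "K = convex hull {a, b, c}" "\<not> collinear {a, b, c}"
    using simplex_2_obtain[OF assms(1)] .
  then have "p \<in> {a, b, c}" "q \<in> {a, b, c}" using assms extreme_point_of_triangle by metis+
  then have "\<exists>s. {p, q, s} = {a, b, c}" using assms(4) by auto
  then show ?thesis using that abc by metis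
qed

lemma simplex_2_affine_interpolation:
  fixes w :: "'a::euclidean_space \<Rightarrow> real"
  assumes "2 simplex K"
  obtains G c where "G \<in> span {y - z |y z. y \<in> K \<and> z \<in> K}"
    "\<And>x. x extreme_point_of K \<Longrightarrow> G \<bullet> x + c = w x"
proof -
  obtain p q s where K: "K = convex hull {p, q, s}" "\<not> collinear {p, q, s}"
    using simplex_2_obtain[OF assms] .
  have nc: "\<not> collinear {q, p, s}" using K(2) by (simp add: insert_commute)
  have mem: "p \<in> K" "q \<in> K" "s \<in> K" by (auto simp: K hull_inc)
  define G where "G = (w p - w s) *\<^sub>R bary_gradient p q s + (w q - w s) *\<^sub>R bary_gradient q p s"
  have "G \<in> span {y - z |y z. y \<in> K \<and> z \<in> K}"
    unfolding G_def by (intro span_add span_scale bary_gradient_in_span mem)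
  moreover have "(p - s) \<bullet> G = w p - w s" "(q - s) \<bullet> G = w q - w s"
    by (simp_all add: G_def inner_add_right bary_gradient_inner[OF K(2)] bary_gradient_inner[OF nc])
  then have "G \<bullet> x + (w s - G \<bullet> s) = w x" if "x extreme_point_of K" for x
    using that extreme_point_of_triangle[OF K(2)] by (auto simp: K(1) inner_diff_left inner_commute[of G])
  ultimately show ?thesis using that by blast
qed

lemma compact_simplex: "n simplex K \<Longrightarrow> compact K" and convex_simplex: "n simplex K \<Longrightarrow> convex K"
  by (auto simp: simplex finite_imp_compact_convex_hull)

section \<open>Integrals over a triangle\<close>

definition ref_triangle :: "(real \<times> real) set" where
  "ref_triangle = {z. 0 \<le> fst z \<and> 0 \<le> snd z \<and> fst z + snd z \<le> 1}"

lemma compact_ref_triangle: "compact ref_triangle"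
proof -
  have "closed ref_triangle"
    unfolding ref_triangle_def
    by (intro closed_Collect_conj closed_Collect_le continuous_intros)
  moreover have "ref_triangle \<subseteq> cbox (0, 0) (1, 1)"
    by (auto simp: ref_triangle_def cbox_Pair_eq)
  ultimately show ?thesis
    by (meson bounded_cbox bounded_subset compact_eq_bounded_closed)
qed

text \<open>The box \<open>[1/4,1/3]\<^sup>2\<close> lies inside the reference triangle and all three barycentric
  coordinates are at least \<open>1/4\<close> on it, so the lemma covers each nodal basis function,
  whichever vertex it belongs to, as well as the constant 1.\<close>

lemma ref_triangle_integral_pos:
  fixes \<phi> :: "real \<times> real \<Rightarrow> real"
  assumes cont: "continuous_on ref_triangle \<phi>"
    and nonneg: "\<And>z. z \<in> ref_triangle \<Longrightarrow> \<phi> z \<ge> 0"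
    and large: "\<And>z :: real \<times> real. 1/4 \<le> fst z \<Longrightarrow> fst z \<le> 1/3 \<Longrightarrow> 1/4 \<le> snd z \<Longrightarrow> snd z \<le> 1/3 \<Longrightarrow> \<phi> z \<ge> 1/4"
  shows "(LINT z:ref_triangle|lborel. \<phi> z) > 0"
proof -
  define B where "B = cbox (1/4 :: real, 1/4 :: real) (1/3, 1/3)"
  have B: "z \<in> B \<longleftrightarrow> 1/4 \<le> fst z \<and> fst z \<le> 1/3 \<and> 1/4 \<le> snd z \<and> snd z \<le> 1/3" for z
    by (cases z) (auto simp: B_def cbox_Pair_eq)
  have BT: "B \<subseteq> ref_triangle" by (auto simp: B ref_triangle_def)
  have int: "integrable lborel (\<lambda>z. indicator ref_triangle z *\<^sub>R \<phi> z)"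
    by (rule borel_integrable_compact[OF compact_ref_triangle cont])
  have mB: "measure lborel B = 1 / 144"
    unfolding B_def by (subst measure_lborel_cbox) (auto simp: Basis_prod_def)
  have "(0::real) < 1/4 * measure lborel B" by (simp add: mB)
  also have "\<dots> = integral\<^sup>L lborel (\<lambda>z. 1/4 * indicator B z)"
    by (simp add: B_def)
  also have "\<dots> \<le> integral\<^sup>L lborel (\<lambda>z. indicator ref_triangle z *\<^sub>R \<phi> z)"
  proof (rule integral_mono[OF _ int])
    show "integrable lborel (\<lambda>z. 1/4 * indicator B z :: real)"
      unfolding B_def
      by (intro integrable_mult_right integrable_real_indicator) (simp, rule emeasure_lborel_cbox_finite)
    fix z
    show "1/4 * indicator B z \<le> indicator ref_triangle z *\<^sub>R \<phi> z"
      using BT nonneg[of z] large[of z] B[of z] by (auto simp: indicator_def)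
  qed
  finally show ?thesis by (simp add: set_lebesgue_integral_def)
qed

text \<open>The parametrisation is an unspecified choice of an ordering of the vertices; this makes it available
  together with the nondegeneracy of the chosen triple.\<close>

lemma triangle_integral_unfold:
  assumes "2 simplex K"
  obtains p q s where "K = convex hull {p, q, s}" "\<not> collinear {p, q, s}"
    "\<forall>g. triangle_integral K g = sqrt (gram p q s) *
       (LINT z:ref_triangle|lborel. g (p + fst z *\<^sub>R (q - p) + snd z *\<^sub>R (s - p)))"
proof -
  define pqs where "pqs = (SOME (p, q, s). K = convex hull {p, q, s})"
  obtain p q s where pqs: "pqs = (p, q, s)" by (metis surj_pair)
  obtain a b c where "K = convex hull {a, b, c}" using simplex_2_obtain[OF assms] by blast
  then have "case (a, b, c) of (p, q, s) \<Rightarrow> K = convex hull {p, q, s}" by simp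
  then have "case pqs of (p, q, s) \<Rightarrow> K = convex hull {p, q, s}"
    unfolding pqs_def by (rule someI)
  then have K: "K = convex hull {p, q, s}" by (simp add: pqs)
  have "norm (cross3 (q - p) (s - p)) = sqrt (gram p q s)"
    by (rule real_sqrt_unique[symmetric]) (simp_all add: norm_cross gram_def)
  then have "triangle_integral K g = sqrt (gram p q s) *
       (LINT z:ref_triangle|lborel. g (p + fst z *\<^sub>R (q - p) + snd z *\<^sub>R (s - p)))" for g
    using pqs unfolding triangle_integral_def pqs_def ref_triangle_def by simp
  then show ?thesis using that K simplex_2_hull_not_collinear[OF assms K] by blast
qed

lemma ref_point_in_triangle:
  "z \<in> ref_triangle \<Longrightarrow> p + fst z *\<^sub>R (q - p) + snd z *\<^sub>R (s - p) \<in> convex hull {p, q, s}"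
  unfolding convex_hull_3_alt ref_triangle_def by blast

text \<open>The parametrisation stays inside \<open>K\<close>, so values elsewhere are irrelevant, and the Lebesgue integral,
  being 0 for nonintegrable functions, is homogeneous on all functions.\<close>

lemma triangle_integral_cong_scale:
  assumes K: "2 simplex K" and eq: "\<And>x. x \<in> K \<Longrightarrow> g x = c * g' x"
  shows "triangle_integral K g = c * triangle_integral K g'"
proof -
  obtain p q s where pqs: "K = convex hull {p, q, s}" "\<not> collinear {p, q, s}"
    "\<forall>g. triangle_integral K g = sqrt (gram p q s) *
       (LINT z:ref_triangle|lborel. g (p + fst z *\<^sub>R (q - p) + snd z *\<^sub>R (s - p)))"
    using triangle_integral_unfold[OF K] .
  have "(LINT z:ref_triangle|lborel. g (p + fst z *\<^sub>R (q - p) + snd z *\<^sub>R (s - p))) =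
    (LINT z:ref_triangle|lborel. c * g' (p + fst z *\<^sub>R (q - p) + snd z *\<^sub>R (s - p)))"
    unfolding set_lebesgue_integral_def
    by (rule Bochner_Integration.integral_cong[OF refl])
      (use eq ref_point_in_triangle[of _ p q s] pqs(1) in \<open>auto simp: indicator_def\<close>)
  then show ?thesis by (simp add: pqs(3)[rule_format])
qed

definition ref_area :: real where
  "ref_area = (LINT z:ref_triangle|lborel. 1)"

lemma ref_area_pos: "ref_area > 0"
  unfolding ref_area_def by (rule ref_triangle_integral_pos) auto

lemma triangle_integral_const:
  assumes "2 simplex K" "K = convex hull {p, q, s}" "\<And>x. x \<in> K \<Longrightarrow> g x = c"
  shows "triangle_integral K g = c * (sqrt (gram p q s) * ref_area)"
proof -
  obtain a b e where *: "K = convex hull {a, b, e}" "\<not> collinear {a, b, e}"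
    "\<forall>g. triangle_integral K g = sqrt (gram a b e) *
       (LINT z:ref_triangle|lborel. g (a + fst z *\<^sub>R (b - a) + snd z *\<^sub>R (e - a)))"
    using triangle_integral_unfold[OF assms(1)] .
  note nc = simplex_2_hull_not_collinear[OF assms(1,2)]
  have "x \<in> {a, b, e} \<longleftrightarrow> x \<in> {p, q, s}" for x
    using extreme_point_of_triangle[OF nc, of x] extreme_point_of_triangle[OF *(2), of x]
    unfolding *(1)[symmetric] assms(2)[symmetric] by blast
  then have "{a, b, e} = {p, q, s}" by blast
  then have "gram a b e = gram p q s" using gram_set_eq *(2) by blast
  then have "triangle_integral K (\<lambda>_. 1) = sqrt (gram p q s) * ref_area"
    by (simp add: *(3)[rule_format] ref_area_def)
  then show ?thesis
    using triangle_integral_cong_scale[OF assms(1), of g c "\<lambda>_. 1"] assms(3) by simp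
qed

lemma triangle_integral_nonneg:
  assumes K: "2 simplex K" and "\<And>x. x \<in> K \<Longrightarrow> g x \<ge> 0"
  shows "triangle_integral K g \<ge> 0"
proof -
  obtain p q s where pqs: "K = convex hull {p, q, s}" "\<not> collinear {p, q, s}"
    "\<forall>g. triangle_integral K g = sqrt (gram p q s) *
       (LINT z:ref_triangle|lborel. g (p + fst z *\<^sub>R (q - p) + snd z *\<^sub>R (s - p)))"
    using triangle_integral_unfold[OF K] .
  have "(LINT z:ref_triangle|lborel. g (p + fst z *\<^sub>R (q - p) + snd z *\<^sub>R (s - p))) \<ge> 0"
    unfolding set_lebesgue_integral_def
    by (intro Bochner_Integration.integral_nonneg)
      (use assms(2) ref_point_in_triangle[of _ p q s] pqs(1) in \<open>auto simp: indicator_def\<close>)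
  then show ?thesis using gram_pos[OF pqs(2)] by (simp add: pqs(3)[rule_format])
qed

lemma triangle_integral_nodal_pos:
  assumes K: "2 simplex K" and p: "p extreme_point_of K"
    and v: "\<And>x. x \<in> K \<Longrightarrow> v x = G \<bullet> x + c"
    and vert: "\<And>q. q extreme_point_of K \<Longrightarrow> v q = (if q = p then 1 else 0)"
  shows "triangle_integral K v > 0"
proof -
  obtain a b e where *: "K = convex hull {a, b, e}" "\<not> collinear {a, b, e}"
    "\<forall>g. triangle_integral K g = sqrt (gram a b e) *
       (LINT z:ref_triangle|lborel. g (a + fst z *\<^sub>R (b - a) + snd z *\<^sub>R (e - a)))"
    using triangle_integral_unfold[OF K] .
  define \<phi> where "\<phi> = (\<lambda>z. v (a + fst z *\<^sub>R (b - a) + snd z *\<^sub>R (e - a)))"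
  have ext: "x extreme_point_of K \<longleftrightarrow> x \<in> {a, b, e}" for x
    using extreme_point_of_triangle[OF *(2)] by (simp add: *(1))
  have ne: "a \<noteq> b" "b \<noteq> e" "a \<noteq> e" using *(2) by (auto simp: insert_commute)
  have mem: "a \<in> K" "b \<in> K" "e \<in> K" by (auto simp: *(1) hull_inc)
  have \<phi>: "\<phi> z = (1 - fst z - snd z) * v a + fst z * v b + snd z * v e" if "z \<in> ref_triangle" for z
  proof -
    have "a + fst z *\<^sub>R (b - a) + snd z *\<^sub>R (e - a) \<in> K"
      using ref_point_in_triangle[OF that] *(1) by simp
    then show ?thesis
      by (simp add: \<phi>_def v mem algebra_simps)
  qed
  have cases: "v a = 1 \<and> v b = 0 \<and> v e = 0 \<or> v a = 0 \<and> v b = 1 \<and> v e = 0 \<or> v a = 0 \<and> v b = 0 \<and> v e = 1"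
    using p vert ne unfolding ext by auto
  have "(LINT z:ref_triangle|lborel. \<phi> z) > 0"
  proof (rule ref_triangle_integral_pos)
    have "continuous_on ref_triangle (\<lambda>z. (1 - fst z - snd z) * v a + fst z * v b + snd z * v e)"
      by (intro continuous_intros)
    then show "continuous_on ref_triangle \<phi>" using \<phi> by (simp cong: continuous_on_cong)
    show "\<phi> z \<ge> 0" if "z \<in> ref_triangle" for z
      using that cases unfolding \<phi>[OF that] by (auto simp: ref_triangle_def)
    show "\<phi> z \<ge> 1/4" if z: "1/4 \<le> fst z" "fst z \<le> 1/3" "1/4 \<le> snd z" "snd z \<le> 1/3" for z
    proof -
      have "z \<in> ref_triangle" using z by (auto simp: ref_triangle_def)
      show ?thesis using z cases unfolding \<phi>[OF \<open>z \<in> ref_triangle\<close>] by auto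
    qed
  qed
  then show ?thesis using gram_pos[OF *(2)] by (simp add: *(3)[rule_format] \<phi>_def)
qed

section \<open>Piecewise affine functions on a conforming triangulation\<close>

locale triangle_mesh =
  fixes \<K> :: "point set set"
  assumes finite_mesh: "finite \<K>"
    and triangle: "K \<in> \<K> \<Longrightarrow> 2 simplex K"
    and conforming: "K \<in> \<K> \<Longrightarrow> L \<in> \<K> \<Longrightarrow> (K \<inter> L) face_of K"
begin

lemma compact_triangle: "K \<in> \<K> \<Longrightarrow> compact K" and convex_triangle: "K \<in> \<K> \<Longrightarrow> convex K"
  using triangle compact_simplex convex_simplex by blast+

lemma triangle_eq_hull_vertices: "K \<in> \<K> \<Longrightarrow> K = convex hull {x. x extreme_point_of K}"
  by (intro Krein_Milman_Minkowski compact_triangle convex_triangle)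

lemma finite_triangle_vertices: "K \<in> \<K> \<Longrightarrow> finite {x. x extreme_point_of K}"
proof -
  assume K: "K \<in> \<K>"
  obtain p q s where "K = convex hull {p, q, s}" "\<not> collinear {p, q, s}"
    using simplex_2_obtain[OF triangle[OF K]] .
  then have "{x. x extreme_point_of K} = {p, q, s}" using extreme_point_of_triangle by blast
  then show ?thesis by simp
qed

lemma finite_vertices: "finite (vertices \<K>)"
proof -
  have "vertices \<K> = (\<Union>K\<in>\<K>. {x. x extreme_point_of K})" by (auto simp: vertices_def)
  then show ?thesis using finite_mesh finite_triangle_vertices by simp
qed

lemma vertex_of_triangle: "K \<in> \<K> \<Longrightarrow> p extreme_point_of K \<Longrightarrow> p \<in> vertices \<K>"
  by (auto simp: vertices_def)

text \<open>The intersection of two triangles is a face of both, so it is the convex hull of points that are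
  vertices of both, and there the two affine functions take the same prescribed values. With
  \<open>K = L\<close> this says that an affine function on a triangle is determined by its vertex values.\<close>

lemma affine_pieces_agree:
  assumes "K \<in> \<K>" "L \<in> \<K>" "x \<in> K" "x \<in> L"
    and "\<And>p. p extreme_point_of K \<Longrightarrow> G \<bullet> p + c = w p"
    and "\<And>p. p extreme_point_of L \<Longrightarrow> G' \<bullet> p + c' = w p"
  shows "G \<bullet> x + c = G' \<bullet> x + c'"
proof (rule affine_eq_on_convex_hull[where S="{p. p extreme_point_of (K \<inter> L)}"])
  have "K \<inter> L = convex hull {p. p extreme_point_of (K \<inter> L)}"
    by (intro Krein_Milman_Minkowski compact_Int convex_Int compact_triangle convex_triangle assms)
  then show "x \<in> convex hull {p. p extreme_point_of (K \<inter> L)}" using assms(3,4) by blast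
next
  fix p assume "p \<in> {p. p extreme_point_of (K \<inter> L)}"
  then have "p extreme_point_of (K \<inter> L)" "p extreme_point_of (L \<inter> K)" by (auto simp: Int_commute)
  then have "p extreme_point_of K" "p extreme_point_of L"
    using extreme_point_of_face[OF conforming[OF assms(1,2)]]
      extreme_point_of_face[OF conforming[OF assms(2,1)]] by blast+
  then show "G \<bullet> p + c = G' \<bullet> p + c'" using assms(5,6) by metis
qed

lemma fe_affine:
  assumes "v \<in> fe_space \<K>" "K \<in> \<K>"
  obtains g c where "\<forall>x\<in>K. v x = g \<bullet> x + c"
  using assms unfolding fe_space_def by blast

text \<open>The linear part of an affine function on a flat triangle is only determined up to normal vectors;
  here it is chosen tangential, which makes it the tangential gradient.\<close>

lemma fe_affine_with_gradient:
  assumes "v \<in> fe_space \<K>" "K \<in> \<K>"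
  obtains G c where "G \<in> span {y - z |y z. y \<in> K \<and> z \<in> K}" "\<forall>x\<in>K. v x = G \<bullet> x + c"
proof -
  obtain g c where g: "\<forall>x\<in>K. v x = g \<bullet> x + c" using fe_affine[OF assms] .
  obtain G c' where G: "G \<in> span {y - z |y z. y \<in> K \<and> z \<in> K}"
    "\<And>x. x extreme_point_of K \<Longrightarrow> G \<bullet> x + c' = v x"
    by (rule simplex_2_affine_interpolation[OF triangle[OF assms(2)], of v]) blast
  have "v x = G \<bullet> x + c'" if "x \<in> K" for x
  proof -
    have "g \<bullet> x + c = G \<bullet> x + c'"
      by (rule affine_pieces_agree[OF assms(2) assms(2) that that, of _ _ v])
        (use g G(2) in \<open>simp_all add: extreme_point_of_def\<close>)
    then show ?thesis using g that by simp
  qed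
  then show ?thesis using that G(1) by blast
qed

lemma fe_eqI:
  assumes "u \<in> fe_space \<K>" "v \<in> fe_space \<K>" "\<And>p. p \<in> vertices \<K> \<Longrightarrow> u p = v p"
  shows "u = v"
proof
  fix x
  show "u x = v x"
  proof (cases "x \<in> \<Union>\<K>")
    case True
    then obtain K where K: "K \<in> \<K>" "x \<in> K" by blast
    obtain g c where g: "\<forall>x\<in>K. u x = g \<bullet> x + c" using fe_affine[OF assms(1) K(1)] .
    obtain g' c' where g': "\<forall>x\<in>K. v x = g' \<bullet> x + c'" using fe_affine[OF assms(2) K(1)] .
    have "g \<bullet> x + c = g' \<bullet> x + c'"
    proof (rule affine_pieces_agree[OF K(1) K(1) K(2) K(2), of _ _ u])
      fix p assume p: "p extreme_point_of K"
      then have "p \<in> K" by (simp add: extreme_point_of_def)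
      then show "g \<bullet> p + c = u p" "g' \<bullet> p + c' = u p"
        using g g' assms(3)[OF vertex_of_triangle[OF K(1) p]] by simp_all
    qed
    then show ?thesis using g g' K by simp
  next
    case False
    then show ?thesis using assms by (simp add: fe_space_def)
  qed
qed

text \<open>Any choice of a triangle around \<open>x\<close> gives the same value, which is what makes the glued function both
  piecewise affine and continuous.\<close>

lemma fe_interpolation_exists:
  fixes w :: "point \<Rightarrow> real"
  obtains v where "v \<in> fe_space \<K>" "\<And>p. p \<in> vertices \<K> \<Longrightarrow> v p = w p"
proof -
  have "\<forall>K\<in>\<K>. \<exists>G c. \<forall>x. x extreme_point_of K \<longrightarrow> G \<bullet> x + c = w x"
    using simplex_2_affine_interpolation[OF triangle] by metis
  then obtain G c where Gc: "\<And>K x. K \<in> \<K> \<Longrightarrow> x extreme_point_of K \<Longrightarrow> G K \<bullet> x + c K = w x"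
    by metis
  define v where "v x = (if x \<in> \<Union>\<K> then G (SOME K. K \<in> \<K> \<and> x \<in> K) \<bullet> x + c (SOME K. K \<in> \<K> \<and> x \<in> K) else 0)" for x
  have v: "v x = G K \<bullet> x + c K" if "K \<in> \<K>" "x \<in> K" for K x
  proof -
    define L where "L = (SOME K. K \<in> \<K> \<and> x \<in> K)"
    have L: "L \<in> \<K> \<and> x \<in> L" unfolding L_def by (rule someI[of _ K]) (use that in blast)
    have "v x = G L \<bullet> x + c L" using that by (auto simp: v_def L_def)
    also have "\<dots> = G K \<bullet> x + c K"
      by (rule affine_pieces_agree[of L K]) (use L that Gc in auto)
    finally show ?thesis .
  qed
  have "v \<in> fe_space \<K>"
    unfolding fe_space_def
  proof (intro CollectI conjI ballI allI impI)
    have "continuous_on K v" if "K \<in> \<K>" for K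
    proof -
      have "continuous_on K (\<lambda>x. G K \<bullet> x + c K)" by (intro continuous_intros)
      then show ?thesis using v[OF that] by (simp cong: continuous_on_cong)
    qed
    then have "continuous_on (\<Union>K\<in>\<K>. K) v"
      using finite_mesh compact_triangle
      by (intro continuous_on_closed_Union) (auto intro: compact_imp_closed)
    then show "continuous_on (\<Union>\<K>) v" by simp
    show "\<exists>g c. \<forall>x\<in>K. v x = g \<bullet> x + c" if "K \<in> \<K>" for K
      using v[OF that] by blast
  qed (simp add: v_def)
  moreover have "v p = w p" if "p \<in> vertices \<K>" for p
  proof -
    obtain K where K: "K \<in> \<K>" "p extreme_point_of K" using \<open>p \<in> vertices \<K>\<close> by (auto simp: vertices_def)
    then show ?thesis using v[of K p] Gc by (auto simp: extreme_point_of_def)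
  qed
  ultimately show ?thesis using that by blast
qed

lemma nodal_basis:
  shows nodal_basis_fe: "nodal_basis \<K> p \<in> fe_space \<K>"
    and nodal_basis_vertex: "q \<in> vertices \<K> \<Longrightarrow> nodal_basis \<K> p q = (if q = p then 1 else 0)"
proof -
  obtain v where v: "v \<in> fe_space \<K>" "\<And>q. q \<in> vertices \<K> \<Longrightarrow> v q = (if q = p then 1 else 0)"
    using fe_interpolation_exists[of "\<lambda>q. if q = p then 1 else 0"] by metis
  have "nodal_basis \<K> p = v"
    unfolding nodal_basis_def
  proof (rule the_equality)
    fix \<xi> assume \<xi>: "\<xi> \<in> fe_space \<K> \<and> (\<forall>q\<in>vertices \<K>. \<xi> q = (if q = p then 1 else 0))"
    show "\<xi> = v"
      by (rule fe_eqI[OF _ v(1)]) (use \<xi> v(2) in simp_all)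
  qed (use v in blast)
  then show "nodal_basis \<K> p \<in> fe_space \<K>"
    "q \<in> vertices \<K> \<Longrightarrow> nodal_basis \<K> p q = (if q = p then 1 else 0)" using v by auto
qed

text \<open>If an affine function were smaller at all vertices than at a point of the triangle, an open half-space
  would contain the vertices, hence their convex hull, but not the point.\<close>

lemma fe_extrema_at_vertices:
  assumes v: "v \<in> fe_space \<K>" and x: "x \<in> \<Union>\<K>"
  shows "\<exists>p\<in>vertices \<K>. v x \<le> v p" "\<exists>p\<in>vertices \<K>. v p \<le> v x"
proof -
  obtain K where K: "K \<in> \<K>" "x \<in> K" using x by blast
  obtain g c where g: "\<forall>x\<in>K. v x = g \<bullet> x + c" using fe_affine[OF v K(1)] .
  have hull: "x \<in> convex hull {p. p extreme_point_of K}"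
    using triangle_eq_hull_vertices[OF K(1)] K(2) by blast
  have ext: "p \<in> vertices \<K>" "v p = g \<bullet> p + c" if "p extreme_point_of K" for p
    using vertex_of_triangle[OF K(1) that] g that by (simp_all add: extreme_point_of_def)
  have "\<not> {p. p extreme_point_of K} \<subseteq> {y. g \<bullet> y < g \<bullet> x}"
    using hull hull_minimal[of "{p. p extreme_point_of K}" "{y. g \<bullet> y < g \<bullet> x}" convex]
      convex_halfspace_lt[of g "g \<bullet> x"] by blast
  then obtain p where p: "p extreme_point_of K" "g \<bullet> x \<le> g \<bullet> p"
    by (auto simp: subset_iff not_less)
  then show "\<exists>p\<in>vertices \<K>. v x \<le> v p"
    using ext[OF p(1)] g K(2) by (intro bexI[of _ p]) simp_all
  have "\<not> {p. p extreme_point_of K} \<subseteq> {y. g \<bullet> y > g \<bullet> x}"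
    using hull hull_minimal[of "{p. p extreme_point_of K}" "{y. g \<bullet> y > g \<bullet> x}" convex]
      convex_halfspace_gt[of "g \<bullet> x" g] by blast
  then obtain p where p: "p extreme_point_of K" "g \<bullet> p \<le> g \<bullet> x"
    by (auto simp: subset_iff not_less)
  then show "\<exists>p\<in>vertices \<K>. v p \<le> v x"
    using ext[OF p(1)] g K(2) by (intro bexI[of _ p]) simp_all
qed

lemma fe_nonneg:
  assumes v: "v \<in> fe_space \<K>" "\<And>p. p \<in> vertices \<K> \<Longrightarrow> v p \<ge> 0"
  shows "v x \<ge> 0"
proof (cases "x \<in> \<Union>\<K>")
  case True
  then obtain p where "p \<in> vertices \<K>" "v p \<le> v x" using fe_extrema_at_vertices(2)[OF v(1)] by blast
  then show ?thesis using v(2)[of p] by simp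
next
  case False
  then show ?thesis using v(1) by (simp add: fe_space_def)
qed

lemma fe_space_lincomb:
  assumes "\<And>i. i \<in> I \<Longrightarrow> v i \<in> fe_space \<K>"
  shows "(\<lambda>x. \<Sum>i\<in>I. a i * v i x) \<in> fe_space \<K>"
  unfolding fe_space_def
proof (intro CollectI conjI ballI allI impI)
  show "continuous_on (\<Union>\<K>) (\<lambda>x. \<Sum>i\<in>I. a i * v i x)"
    using assms by (intro continuous_intros) (auto simp: fe_space_def)
  fix K assume K: "K \<in> \<K>"
  then have "\<forall>i\<in>I. \<exists>g c. \<forall>x\<in>K. v i x = g \<bullet> x + c" using assms by (auto simp: fe_space_def)
  then obtain g c where gc: "\<And>i x. i \<in> I \<Longrightarrow> x \<in> K \<Longrightarrow> v i x = g i \<bullet> x + c i" by metis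
  show "\<exists>g c. \<forall>x\<in>K. (\<Sum>i\<in>I. a i * v i x) = g \<bullet> x + c"
    by (intro exI[of _ "\<Sum>i\<in>I. a i *\<^sub>R g i"] exI[of _ "\<Sum>i\<in>I. a i * c i"])
      (simp add: gc inner_sum_left sum.distrib algebra_simps)
next
  fix x assume "x \<notin> \<Union>\<K>"
  then have "v i x = 0" if "i \<in> I" for i using assms[OF that] by (auto simp: fe_space_def)
  then show "(\<Sum>i\<in>I. a i * v i x) = 0" by simp
qed

lemma nodal_sum_vertex:
  "q \<in> vertices \<K> \<Longrightarrow> (\<Sum>p\<in>vertices \<K>. w p * nodal_basis \<K> p q) = w q"
  using finite_vertices by (simp add: nodal_basis_vertex if_distrib cong: if_cong)

lemma fe_nodal_expansion:
  assumes "v \<in> fe_space \<K>"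
  shows "v x = (\<Sum>p\<in>vertices \<K>. v p * nodal_basis \<K> p x)"
proof -
  have "v = (\<lambda>x. \<Sum>p\<in>vertices \<K>. v p * nodal_basis \<K> p x)"
    by (rule fe_eqI[OF assms fe_space_lincomb]) (simp_all add: nodal_basis_fe nodal_sum_vertex)
  then show ?thesis by (rule fun_cong)
qed

lemma nodal_basis_sum_eq_1:
  assumes "x \<in> \<Union>\<K>"
  shows "(\<Sum>p\<in>vertices \<K>. nodal_basis \<K> p x) = 1"
proof -
  define one where "one = (\<lambda>x. if x \<in> \<Union>\<K> then 1 else 0::real)"
  have "one \<in> fe_space \<K>"
    unfolding fe_space_def
  proof (intro CollectI conjI ballI allI impI)
    show "continuous_on (\<Union>\<K>) one"
      by (rule continuous_on_eq[OF continuous_on_const[of _ 1]]) (simp add: one_def)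
    show "\<exists>g c. \<forall>x\<in>K. one x = g \<bullet> x + c" if "K \<in> \<K>" for K
      using that by (intro exI[of _ 0] exI[of _ 1]) (auto simp: one_def)
  qed (simp add: one_def)
  moreover have "one p = 1" if "p \<in> vertices \<K>" for p
    using that by (auto simp: one_def vertices_def extreme_point_of_def)
  ultimately show ?thesis using fe_nodal_expansion[of one x] assms by (simp add: one_def)
qed

text \<open>The constant \<open>a\<close> is free since the nodal basis sums to one. Choosing for \<open>a\<close> the value at the
  vertex under consideration later eliminates the diagonal of the stiffness matrix.\<close>

lemma tangential_gradient_fe:
  assumes v: "v \<in> fe_space \<K>" and K: "K \<in> \<K>" "x \<in> K"
  shows "tangential_gradient K v x =
    (\<Sum>q\<in>vertices \<K>. (v q - a) *\<^sub>R tangential_gradient K (nodal_basis \<K> q) x)"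
proof -
  define D where "D = span {y - z |y z. y \<in> K \<and> z \<in> K}"
  have "\<exists>G c. G \<in> D \<and> (\<forall>x\<in>K. nodal_basis \<K> q x = G \<bullet> x + c)" for q
    unfolding D_def using fe_affine_with_gradient[OF nodal_basis_fe K(1), of q] by blast
  then obtain G c where "\<And>q. G q \<in> D \<and> (\<forall>y\<in>K. nodal_basis \<K> q y = G q \<bullet> y + c q)"
    by metis
  then have G: "\<And>q. G q \<in> span {y - z |y z. y \<in> K \<and> z \<in> K}"
    "\<And>q y. y \<in> K \<Longrightarrow> nodal_basis \<K> q y = G q \<bullet> y + c q" unfolding D_def by blast+
  have tg: "tangential_gradient K (nodal_basis \<K> q) x = G q" for q
    by (rule tangential_gradient_eqI[OF convex_triangle[OF K(1)] K(2) G])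
  show ?thesis
    unfolding tg
  proof (rule tangential_gradient_eqI[OF convex_triangle[OF K(1)] K(2)])
    show "(\<Sum>q\<in>vertices \<K>. (v q - a) *\<^sub>R G q) \<in> span {y - z |y z. y \<in> K \<and> z \<in> K}"
      by (intro span_sum span_scale G)
    fix y assume y: "y \<in> K"
    then have "(\<Sum>q\<in>vertices \<K>. nodal_basis \<K> q y) = 1" using K by (intro nodal_basis_sum_eq_1) auto
    then have "v y = (\<Sum>q\<in>vertices \<K>. v q * nodal_basis \<K> q y) - a * (\<Sum>q\<in>vertices \<K>. nodal_basis \<K> q y) + a"
      using fe_nodal_expansion[OF v, of y] by simp
    also have "\<dots> = (\<Sum>q\<in>vertices \<K>. (v q - a) * nodal_basis \<K> q y) + a"
      by (simp add: sum_distrib_left sum_subtractf left_diff_distrib)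
    also have "\<dots> = (\<Sum>q\<in>vertices \<K>. (v q - a) *\<^sub>R G q) \<bullet> y + ((\<Sum>q\<in>vertices \<K>. (v q - a) * c q) + a)"
      by (simp add: G(2)[OF y] inner_sum_left distrib_left sum.distrib)
    finally show "v y = (\<Sum>q\<in>vertices \<K>. (v q - a) *\<^sub>R G q) \<bullet> y + ((\<Sum>q\<in>vertices \<K>. (v q - a) * c q) + a)" .
  qed
qed

definition stiffness :: "point \<Rightarrow> point \<Rightarrow> real" where
  "stiffness p q = surface_integral \<K> (\<lambda>K x.
     tangential_gradient K (nodal_basis \<K> p) x \<bullet> tangential_gradient K (nodal_basis \<K> q) x)"

definition lumped_mass :: "point \<Rightarrow> real" where
  "lumped_mass p = surface_integral \<K> (\<lambda>K. nodal_basis \<K> p)"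

lemma tangential_gradient_fe_const:
  assumes "v \<in> fe_space \<K>" "K \<in> \<K>"
  obtains G where "\<forall>x\<in>K. tangential_gradient K v x = G"
proof -
  obtain G c where G: "G \<in> span {y - z |y z. y \<in> K \<and> z \<in> K}" "\<forall>x\<in>K. v x = G \<bullet> x + c"
    using fe_affine_with_gradient[OF assms] .
  have "tangential_gradient K v x = G" if "x \<in> K" for x
    by (rule tangential_gradient_eqI[OF convex_triangle[OF assms(2)] that G(1)]) (use G(2) in blast)
  then show ?thesis using that by blast
qed

lemma surface_integral_gradients:
  assumes v: "v \<in> fe_space \<K>"
  shows "surface_integral \<K> (\<lambda>K x.
     tangential_gradient K v x \<bullet> tangential_gradient K (nodal_basis \<K> p) x) =
     (\<Sum>q\<in>vertices \<K>. (v q - a) * stiffness q p)"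
proof -
  have "triangle_integral K (\<lambda>x. tangential_gradient K v x \<bullet> tangential_gradient K (nodal_basis \<K> p) x)
     = (\<Sum>q\<in>vertices \<K>. (v q - a) * triangle_integral K (\<lambda>x.
         tangential_gradient K (nodal_basis \<K> q) x \<bullet> tangential_gradient K (nodal_basis \<K> p) x))"
    if K: "K \<in> \<K>" for K
  proof -
    have "\<exists>G. \<forall>x\<in>K. tangential_gradient K (nodal_basis \<K> q) x = G" for q
      by (rule tangential_gradient_fe_const[OF nodal_basis_fe K, of q]) blast
    then obtain G where G: "\<And>q x. x \<in> K \<Longrightarrow> tangential_gradient K (nodal_basis \<K> q) x = G q" by metis
    have 1: "triangle_integral K g = c * triangle_integral K (\<lambda>x. 1)" if "\<And>x. x \<in> K \<Longrightarrow> g x = c" for g c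
      by (rule triangle_integral_cong_scale[OF triangle[OF K]]) (use that in simp)
    have "triangle_integral K (\<lambda>x. tangential_gradient K v x \<bullet> tangential_gradient K (nodal_basis \<K> p) x)
      = (\<Sum>q\<in>vertices \<K>. (v q - a) * (G q \<bullet> G p)) * triangle_integral K (\<lambda>x. 1)"
    proof (rule 1)
      fix x assume x: "x \<in> K"
      show "tangential_gradient K v x \<bullet> tangential_gradient K (nodal_basis \<K> p) x
        = (\<Sum>q\<in>vertices \<K>. (v q - a) * (G q \<bullet> G p))"
        unfolding tangential_gradient_fe[OF v K x, of a] G[OF x] by (simp add: inner_sum_left)
    qed
    also have "\<dots> = (\<Sum>q\<in>vertices \<K>. (v q - a) * triangle_integral K (\<lambda>x.
         tangential_gradient K (nodal_basis \<K> q) x \<bullet> tangential_gradient K (nodal_basis \<K> p) x))"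
      unfolding sum_distrib_right
    proof (rule sum.cong[OF refl])
      fix q
      have "triangle_integral K (\<lambda>x. tangential_gradient K (nodal_basis \<K> q) x \<bullet>
          tangential_gradient K (nodal_basis \<K> p) x) = (G q \<bullet> G p) * triangle_integral K (\<lambda>x. 1)"
        by (rule 1) (simp add: G)
      then show "(v q - a) * (G q \<bullet> G p) * triangle_integral K (\<lambda>x. 1) =
        (v q - a) * triangle_integral K (\<lambda>x. tangential_gradient K (nodal_basis \<K> q) x \<bullet>
          tangential_gradient K (nodal_basis \<K> p) x)" by simp
    qed
    finally show ?thesis .
  qed
  then show ?thesis
    unfolding surface_integral_def stiffness_def sum_distrib_left
    by (subst sum.swap) (rule sum.cong[OF refl])
qed

text \<open>A triangle at the vertex contributes a positive amount, the others a nonnegative one.\<close>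

lemma lumped_mass_pos:
  assumes "p \<in> vertices \<K>"
  shows "lumped_mass p > 0"
proof -
  obtain K where K: "K \<in> \<K>" "p extreme_point_of K" using assms by (auto simp: vertices_def)
  obtain G c where G: "G \<in> span {y - z |y z. y \<in> K \<and> z \<in> K}" "\<forall>x\<in>K. nodal_basis \<K> p x = G \<bullet> x + c"
    using fe_affine_with_gradient[OF nodal_basis_fe K(1)] .
  have "triangle_integral K (nodal_basis \<K> p) > 0"
  proof (rule triangle_integral_nodal_pos[OF triangle[OF K(1)] K(2)])
    show "nodal_basis \<K> p x = G \<bullet> x + c" if "x \<in> K" for x using G(2) that by blast
    show "nodal_basis \<K> p q = (if q = p then 1 else 0)" if "q extreme_point_of K" for q
      by (intro nodal_basis_vertex vertex_of_triangle[OF K(1) that])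
  qed
  moreover have "triangle_integral L (nodal_basis \<K> p) \<ge> 0" if "L \<in> \<K>" for L
    by (rule triangle_integral_nonneg[OF triangle[OF that]], rule fe_nonneg[OF nodal_basis_fe])
      (simp add: nodal_basis_vertex)
  ultimately show ?thesis
    unfolding lumped_mass_def surface_integral_def
    using finite_mesh K(1) by (intro sum_pos2[of \<K> K])
qed

text \<open>Interpolating the product with a nodal basis function sees only the value at one vertex: this
  decoupling of the time derivatives is the purpose of mass lumping.\<close>

lemma surface_integral_lumped:
  assumes "p \<in> vertices \<K>"
  shows "surface_integral \<K> (\<lambda>K. nodal_interpolant \<K> (\<lambda>x. w x * nodal_basis \<K> p x)) = w p * lumped_mass p"
proof -
  have eq: "nodal_interpolant \<K> (\<lambda>x. w x * nodal_basis \<K> p x) = (\<lambda>x. w p * nodal_basis \<K> p x)"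
  proof
    fix x
    have "nodal_interpolant \<K> (\<lambda>x. w x * nodal_basis \<K> p x) x =
        (\<Sum>q\<in>vertices \<K>. if q = p then w p * nodal_basis \<K> p x else 0)"
      unfolding nodal_interpolant_def by (rule sum.cong) (auto simp: nodal_basis_vertex)
    then show "nodal_interpolant \<K> (\<lambda>x. w x * nodal_basis \<K> p x) x = w p * nodal_basis \<K> p x"
      using finite_vertices assms by simp
  qed
  show ?thesis
    unfolding eq surface_integral_def lumped_mass_def sum_distrib_left
    by (intro sum.cong refl triangle_integral_cong_scale triangle)
qed

end

section \<open>The sign of the stiffness matrix\<close>

lemma edge_of_triangle:
  fixes p q s :: point
  assumes "\<not> collinear {p, q, s}"
  shows "(convex hull {p, q}) edge_of (convex hull {p, q, s})"
proof -
  have ne: "p \<noteq> q" "q \<noteq> s" "p \<noteq> s" using assms by (auto simp: insert_commute)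
  have "s \<notin> affine hull {p, q}" using assms collinear_3_affine_hull[OF ne(1)] by blast
  moreover have "{p, q, s} - {p, q} = {s}" using ne by auto
  ultimately have "(convex hull {p, q}) face_of (convex hull {p, q, s})"
    by (intro face_of_convex_hulls) auto
  then show ?thesis using ne(1) by (simp add: edge_of_def aff_dim_convex_hull aff_dim_2)
qed

text \<open>The sine is twice the area divided by the product of the edge lengths, so the quotient is the
  cotangent of the angle.\<close>

lemma cos_sin_angle_at:
  fixes p q s :: "'a::euclidean_space"
  assumes "\<not> collinear {p, q, s}"
  defines "\<alpha> \<equiv> angle_at s p q"
  shows "sin \<alpha> > 0" "((p - s) \<bullet> (q - s)) / sqrt (gram s p q) = cos \<alpha> / sin \<alpha>"
proof -
  define n where "n = norm (p - s) * norm (q - s)"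
  have g: "gram s p q > 0" using assms by (intro gram_pos) (simp add: insert_commute)
  have "p \<noteq> s" "q \<noteq> s" using assms by (auto simp: insert_commute)
  then have n: "n > 0" by (simp add: n_def)
  have "\<bar>(p - s) \<bullet> (q - s)\<bar> \<le> n" unfolding n_def by (rule Cauchy_Schwarz_ineq2)
  then have le: "- 1 \<le> ((p - s) \<bullet> (q - s)) / n" "((p - s) \<bullet> (q - s)) / n \<le> 1"
    using n by (auto simp: field_simps)
  have c: "cos \<alpha> = ((p - s) \<bullet> (q - s)) / n"
    unfolding \<alpha>_def angle_at_def n_def[symmetric] using le by (rule cos_arccos)
  have "sin \<alpha> = sqrt (1 - (((p - s) \<bullet> (q - s)) / n)\<^sup>2)"
    unfolding \<alpha>_def angle_at_def n_def[symmetric] using le by (rule sin_arccos)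
  also have "1 - (((p - s) \<bullet> (q - s)) / n)\<^sup>2 = gram s p q / n\<^sup>2"
  proof -
    have "gram s p q = n\<^sup>2 - ((p - s) \<bullet> (q - s))\<^sup>2"
      by (simp add: gram_def n_def power_mult_distrib)
    then show ?thesis using n by (simp add: field_simps power_divide)
  qed
  also have "sqrt (gram s p q / n\<^sup>2) = sqrt (gram s p q) / n"
    using n by (simp add: real_sqrt_divide)
  finally have s: "sin \<alpha> = sqrt (gram s p q) / n" .
  show "sin \<alpha> > 0" using s g n by simp
  show "((p - s) \<bullet> (q - s)) / sqrt (gram s p q) = cos \<alpha> / sin \<alpha>"
    using g n by (simp add: s c)
qed

text \<open>\<open>cot \<alpha> + cot \<beta> = sin (\<alpha> + \<beta>) / (sin \<alpha> sin \<beta>)\<close>.\<close>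

lemma cot_sum_nonneg:
  fixes \<alpha> \<beta> :: real
  assumes "sin \<alpha> > 0" "sin \<beta> > 0" "0 \<le> \<alpha> + \<beta>" "\<alpha> + \<beta> \<le> pi"
  shows "cos \<alpha> / sin \<alpha> + cos \<beta> / sin \<beta> \<ge> 0"
proof -
  have "cos \<alpha> / sin \<alpha> + cos \<beta> / sin \<beta> = sin (\<alpha> + \<beta>) / (sin \<alpha> * sin \<beta>)"
    using assms(1,2) by (simp add: sin_add field_simps)
  moreover have "sin (\<alpha> + \<beta>) \<ge> 0" using assms by (intro sin_ge_zero)
  ultimately show ?thesis using assms(1,2) by simp
qed

lemma angle_at_nonneg: "angle_at s p q \<ge> 0"
  unfolding angle_at_def
proof (rule arccos_lbound)
  have *: "\<bar>(p - s) \<bullet> (q - s)\<bar> \<le> norm (p - s) * norm (q - s)" by (rule Cauchy_Schwarz_ineq2)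
  have "\<bar>(p - s) \<bullet> (q - s) / (norm (p - s) * norm (q - s))\<bar> \<le> 1"
    using * by (cases "p = s \<or> q = s") (auto simp: abs_divide)
  then show "- 1 \<le> (p - s) \<bullet> (q - s) / (norm (p - s) * norm (q - s))"
    "(p - s) \<bullet> (q - s) / (norm (p - s) * norm (q - s)) \<le> 1" by linarith+
qed

context triangle_mesh
begin

lemma nodal_basis_eq_affine:
  assumes "K \<in> \<K>" "\<And>q. q extreme_point_of K \<Longrightarrow> G \<bullet> q + c = (if q = p then 1 else 0)" "x \<in> K"
  shows "nodal_basis \<K> p x = G \<bullet> x + c"
proof -
  obtain g c' where g: "\<forall>x\<in>K. nodal_basis \<K> p x = g \<bullet> x + c'"
    using fe_affine[OF nodal_basis_fe assms(1)] .
  have "g \<bullet> x + c' = G \<bullet> x + c"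
  proof (rule affine_pieces_agree[OF assms(1,1,3,3), of _ _ "\<lambda>q. if q = p then 1 else 0"])
    fix q assume q: "q extreme_point_of K"
    then have "q \<in> K" by (simp add: extreme_point_of_def)
    then show "g \<bullet> q + c' = (if q = p then 1 else 0)"
      using nodal_basis_vertex[OF vertex_of_triangle[OF assms(1) q], of p] g by simp
  qed (use assms(2) in blast)
  then show ?thesis using g assms(3) by simp
qed

lemma tangential_gradient_nodal_basis:
  assumes K: "K \<in> \<K>" "K = convex hull {p, q, s}" and x: "x \<in> K"
  shows "tangential_gradient K (nodal_basis \<K> p) x = bary_gradient p q s"
proof -
  have nc: "\<not> collinear {p, q, s}" using simplex_2_hull_not_collinear[OF triangle] K by blast
  have ne: "p \<noteq> q" "q \<noteq> s" "p \<noteq> s" using nc by (auto simp: insert_commute)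
  have mem: "p \<in> K" "q \<in> K" "s \<in> K" by (auto simp: K(2) hull_inc)
  define G where "G = bary_gradient p q s"
  have "(p - s) \<bullet> G = 1" "(q - s) \<bullet> G = 0" unfolding G_def by (rule bary_gradient_inner[OF nc])+
  then have "G \<bullet> y + (- (G \<bullet> s)) = (if y = p then 1 else 0)" if "y extreme_point_of K" for y
    using that ne extreme_point_of_triangle[OF nc, of y]
    by (auto simp: K(2) inner_diff_left inner_commute[of G])
  then have "nodal_basis \<K> p y = G \<bullet> y + (- (G \<bullet> s))" if "y \<in> K" for y
    using nodal_basis_eq_affine[OF K(1) _ that] by blast
  then show ?thesis
    unfolding G_def[symmetric]
    by (intro tangential_gradient_eqI[OF convex_triangle[OF K(1)] x])
      (use bary_gradient_in_span[OF mem] in \<open>auto simp: G_def\<close>)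
qed

lemma tangential_gradient_nodal_basis_0:
  assumes K: "K \<in> \<K>" "\<not> p extreme_point_of K" and x: "x \<in> K"
  shows "tangential_gradient K (nodal_basis \<K> p) x = 0"
proof (rule tangential_gradient_eqI[OF convex_triangle[OF K(1)] x])
  show "nodal_basis \<K> p y = 0 \<bullet> y + 0" if "y \<in> K" for y
    by (rule nodal_basis_eq_affine[OF K(1) _ that]) (use K(2) in auto)
qed (rule span_zero)

text \<open>The cotangent formula. The reference triangle has area one half, so this is the familiar factor
  \<open>- 1/2\<close>; only its sign matters.\<close>

lemma local_stiffness:
  assumes K: "K \<in> \<K>" "K = convex hull {p, q, s}"
  shows "triangle_integral K (\<lambda>x. tangential_gradient K (nodal_basis \<K> p) x \<bullet>
      tangential_gradient K (nodal_basis \<K> q) x)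
    = - ref_area * (cos (angle_at s p q) / sin (angle_at s p q))"
proof -
  have nc: "\<not> collinear {p, q, s}" using simplex_2_hull_not_collinear[OF triangle] K by blast
  have g: "gram s p q > 0" using nc by (intro gram_pos) (simp add: insert_commute)
  have K': "K = convex hull {q, p, s}" using K(2) by (simp add: insert_commute)
  have "triangle_integral K (\<lambda>x. tangential_gradient K (nodal_basis \<K> p) x \<bullet>
      tangential_gradient K (nodal_basis \<K> q) x)
    = - ((p - s) \<bullet> (q - s)) / gram s p q * (sqrt (gram p q s) * ref_area)"
    by (rule triangle_integral_const[OF triangle[OF K(1)] K(2)])
      (simp only: tangential_gradient_nodal_basis[OF K] tangential_gradient_nodal_basis[OF K(1) K']
        bary_gradient_inner_bary_gradient[OF nc])
  also have "gram p q s = gram s p q"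
    using gram_swap[of p q s] gram_rotate[of p s q] by simp
  also have "- ((p - s) \<bullet> (q - s)) / gram s p q * (sqrt (gram s p q) * ref_area) =
     - ref_area * (((p - s) \<bullet> (q - s)) * (sqrt (gram s p q) / gram s p q))"
    by simp
  also have "sqrt (gram s p q) / gram s p q = 1 / sqrt (gram s p q)"
    using g by (simp add: field_simps)
  also have "((p - s) \<bullet> (q - s)) * (1 / sqrt (gram s p q)) = cos (angle_at s p q) / sin (angle_at s p q)"
    using cos_sin_angle_at(2)[OF nc] by simp
  finally show ?thesis .
qed

lemma edge_triangles:
  assumes "p \<noteq> q"
  shows "{K \<in> \<K>. p extreme_point_of K \<and> q extreme_point_of K} = {K \<in> \<K>. (convex hull {p, q}) edge_of K}"
proof (intro Collect_cong conj_cong refl iffI)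
  fix K assume K: "K \<in> \<K>" "p extreme_point_of K \<and> q extreme_point_of K"
  then obtain s where "K = convex hull {p, q, s}" "\<not> collinear {p, q, s}"
    using simplex_2_two_vertices[OF triangle[OF K(1)] _ _ assms] by blast
  then show "(convex hull {p, q}) edge_of K" using edge_of_triangle by blast
next
  fix K assume "(convex hull {p, q}) edge_of K"
  then have "(convex hull {p, q}) face_of K" by (simp add: edge_of_def)
  then show "p extreme_point_of K \<and> q extreme_point_of K"
    using extreme_point_of_face extreme_point_of_convex_hull_2 by metis
qed

text \<open>Only triangles that contain both vertices contribute. If there are any, they are the two triangles
  sharing the edge \<open>pq\<close>, and the entry is a negative multiple of the sum of the cotangents of the two
  angles opposite to that edge.\<close>

lemma stiffness_nonpos:
  assumes closed: "\<And>K e. K \<in> \<K> \<Longrightarrow> e edge_of K \<Longrightarrow> card {L \<in> \<K>. e edge_of L} = 2"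
    and angles: "angle_condition \<K>" and ne: "p \<noteq> q"
  shows "stiffness p q \<le> 0"
proof -
  define a where "a = (\<lambda>K. triangle_integral K (\<lambda>x. tangential_gradient K (nodal_basis \<K> p) x \<bullet>
      tangential_gradient K (nodal_basis \<K> q) x))"
  define E where "E = {K \<in> \<K>. p extreme_point_of K \<and> q extreme_point_of K}"
  have a0: "a K = 0" if "K \<in> \<K> - E" for K
  proof -
    have "triangle_integral K (\<lambda>x. tangential_gradient K (nodal_basis \<K> p) x \<bullet>
        tangential_gradient K (nodal_basis \<K> q) x) = 0 * triangle_integral K (\<lambda>_. 1)"
      by (rule triangle_integral_cong_scale)
        (use that triangle tangential_gradient_nodal_basis_0 in \<open>auto simp: E_def\<close>)
    then show ?thesis by (simp add: a_def)
  qed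
  have sum: "stiffness p q = (\<Sum>K\<in>E. a K)"
    unfolding stiffness_def surface_integral_def a_def[symmetric]
    by (rule sum.mono_neutral_right[OF finite_mesh]) (use a0 in \<open>auto simp: E_def a_def\<close>)
  show ?thesis
  proof (cases "E = {}")
    case True
    then show ?thesis using sum by simp
  next
    case False
    then obtain K where K: "K \<in> E" by blast
    then have "K \<in> {K \<in> \<K>. (convex hull {p, q}) edge_of K}" using edge_triangles[OF ne] by (simp add: E_def)
    then have "card E = 2" using closed[of K "convex hull {p, q}"] edge_triangles[OF ne] by (simp add: E_def)
    then obtain K1 K2 where E: "E = {K1, K2}" "K1 \<noteq> K2" by (auto simp: card_2_iff)
    have third: "\<exists>s. L = convex hull {p, q, s} \<and> \<not> collinear {p, q, s}" if "L \<in> E" for L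
      using that simplex_2_two_vertices[OF triangle _ _ ne, of L] unfolding E_def by blast
    obtain s1 where s1: "K1 = convex hull {p, q, s1}" "\<not> collinear {p, q, s1}" using third E by blast
    obtain s2 where s2: "K2 = convex hull {p, q, s2}" "\<not> collinear {p, q, s2}" using third E by blast
    have mem: "K1 \<in> \<K>" "K2 \<in> \<K>" using E by (auto simp: E_def)
    define \<alpha> \<beta> where "\<alpha> = angle_at s1 p q" and "\<beta> = angle_at s2 p q"
    have "\<alpha> + \<beta> \<le> pi"
      using angles mem E(2) s1(1) s2(1) unfolding angle_condition_def \<alpha>_def \<beta>_def by blast
    then have "cos \<alpha> / sin \<alpha> + cos \<beta> / sin \<beta> \<ge> 0"
      using cos_sin_angle_at(1)[OF s1(2)] cos_sin_angle_at(1)[OF s2(2)]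
        angle_at_nonneg[of s1 p q] angle_at_nonneg[of s2 p q]
      unfolding \<alpha>_def \<beta>_def by (intro cot_sum_nonneg) auto
    moreover have "stiffness p q = - ref_area * (cos \<alpha> / sin \<alpha> + cos \<beta> / sin \<beta>)"
      using E(2) local_stiffness[OF mem(1) s1(1)] local_stiffness[OF mem(2) s2(1)]
      unfolding sum E(1) a_def \<alpha>_def \<beta>_def by (simp add: distrib_left)
    ultimately show ?thesis using ref_area_pos by (simp add: mult_nonneg_nonneg)
  qed
qed

end

section \<open>Invariance of hyper-rectangles\<close>

lemma closed_hyper_rectangle: "closed (hyper_rectangle m M)"
proof -
  have "hyper_rectangle m M = (\<Inter>k. {u. m k \<le> ereal (u $ k) \<and> ereal (u $ k) \<le> M k})"
    by (auto simp: hyper_rectangle_def)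
  also have "closed \<dots>"
    by (intro closed_INT ballI closed_Collect_conj closed_Collect_le continuous_intros)
  finally show ?thesis .
qed

text \<open>A point of the hyper-rectangle with a coordinate equal to one of the bounds is a boundary point,
  because moving it outwards in that coordinate leaves the set.\<close>

lemma flux_at_face:
  fixes m M :: "'r::finite \<Rightarrow> ereal" and f :: "real^'r \<Rightarrow> real^'r"
  assumes flux: "\<And>u n. u \<in> frontier (hyper_rectangle m M) \<Longrightarrow> n \<in> outward_normals m M u \<Longrightarrow>
                 f u \<bullet> n < 0"
    and u: "u \<in> hyper_rectangle m M"
  shows "ereal (u $ k) = M k \<Longrightarrow> f u $ k < 0" "ereal (u $ k) = m k \<Longrightarrow> f u $ k > 0"
proof -
  have interior: "\<exists>e>0. u + (\<sigma> * e) *\<^sub>R axis k 1 \<in> hyper_rectangle m M"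
    if int: "u \<in> interior (hyper_rectangle m M)" and \<sigma>: "\<bar>\<sigma>\<bar> = 1" for \<sigma> :: real
  proof -
    obtain r where r: "r > 0" "ball u r \<subseteq> hyper_rectangle m M" using int unfolding mem_interior by blast
    have "dist u (u + (\<sigma> * (r / 2)) *\<^sub>R axis k 1) = \<bar>\<sigma>\<bar> * (r / 2)"
      using r(1) by (simp add: dist_norm norm_axis_1 abs_mult)
    then have "u + (\<sigma> * (r / 2)) *\<^sub>R axis k 1 \<in> ball u r" using r(1) \<sigma> by simp
    then have "u + (\<sigma> * (r / 2)) *\<^sub>R axis k 1 \<in> hyper_rectangle m M" using r(2) by blast
    moreover have "r / 2 > 0" using r(1) by simp
    ultimately show ?thesis by blast
  qed
  have comp: "(u + c *\<^sub>R axis k 1) $ k = u $ k + c" for c by simp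
  show "f u $ k < 0" if "ereal (u $ k) = M k"
  proof -
    have "u \<notin> interior (hyper_rectangle m M)"
    proof
      assume "u \<in> interior (hyper_rectangle m M)"
      then obtain e where e: "e > 0" "u + (1 * e) *\<^sub>R axis k 1 \<in> hyper_rectangle m M"
        using interior[of 1] by (metis abs_one)
      have "ereal ((u + (1 * e) *\<^sub>R axis k 1) $ k) \<le> M k"
        using e(2) unfolding hyper_rectangle_def by blast
      then have "ereal (u $ k + e) \<le> M k" by (simp only: comp mult_1)
      then show False using e(1) by (simp add: that[symmetric])
    qed
    then have "u \<in> frontier (hyper_rectangle m M)"
      using u by (simp add: frontier_def closure_closed[OF closed_hyper_rectangle])
    moreover have "axis k 1 \<in> outward_normals m M u" using that by (auto simp: outward_normals_def)
    ultimately have "f u \<bullet> axis k 1 < 0" by (rule flux)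
    then show ?thesis by (simp add: inner_axis)
  qed
  show "f u $ k > 0" if "ereal (u $ k) = m k"
  proof -
    have "u \<notin> interior (hyper_rectangle m M)"
    proof
      assume "u \<in> interior (hyper_rectangle m M)"
      then obtain e where e: "e > 0" "u + (- 1 * e) *\<^sub>R axis k 1 \<in> hyper_rectangle m M"
        using interior[of "- 1"] by (metis abs_minus_cancel abs_one)
      have "m k \<le> ereal ((u + (- 1 * e) *\<^sub>R axis k 1) $ k)"
        using e(2) unfolding hyper_rectangle_def by blast
      then have "m k \<le> ereal (u $ k + (- 1 * e))" by (simp only: comp)
      then show False using e(1) by (simp add: that[symmetric])
    qed
    then have "u \<in> frontier (hyper_rectangle m M)"
      using u by (simp add: frontier_def closure_closed[OF closed_hyper_rectangle])
    moreover have "- axis k 1 \<in> outward_normals m M u" using that by (auto simp: outward_normals_def)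
    ultimately have "f u \<bullet> - axis k 1 < 0" by (rule flux)
    then show ?thesis by (simp add: inner_axis)
  qed
qed

context triangle_mesh
begin

definition nodal_rhs ::
    "('r::finite \<Rightarrow> real) \<Rightarrow> (real^'r \<Rightarrow> real^'r) \<Rightarrow> (point \<Rightarrow> real^'r) \<Rightarrow> point \<Rightarrow> 'r \<Rightarrow> real" where
  "nodal_rhs d f u p k =
     f (u p) $ k - d k / lumped_mass p * (\<Sum>q\<in>vertices \<K>. (u q $ k - u p $ k) * stiffness q p)"

lemma nodal_equation:
  assumes u: "(\<lambda>x. u x $ k) \<in> fe_space \<K>" and p: "p \<in> vertices \<K>"
    and eq: "surface_integral \<K> (\<lambda>K. nodal_interpolant \<K> (\<lambda>x. v x $ k * nodal_basis \<K> p x))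
           + d k * surface_integral \<K> (\<lambda>K x.
               tangential_gradient K (\<lambda>y. u y $ k) x \<bullet> tangential_gradient K (nodal_basis \<K> p) x)
           = surface_integral \<K> (\<lambda>K. nodal_interpolant \<K> (\<lambda>x. f (u x) $ k * nodal_basis \<K> p x))"
  shows "v p $ k = nodal_rhs d f u p k"
proof -
  have "v p $ k * lumped_mass p + d k * (\<Sum>q\<in>vertices \<K>. (u q $ k - u p $ k) * stiffness q p)
      = f (u p) $ k * lumped_mass p"
    using eq unfolding surface_integral_lumped[OF p] surface_integral_gradients[OF u, of _ "u p $ k"] .
  then show ?thesis using lumped_mass_pos[OF p] by (simp add: nodal_rhs_def field_simps)
qed

text \<open>Upper bounds are the case \<open>\<sigma> = 1\<close>, lower bounds the case \<open>\<sigma> = - 1\<close>. At a vertex where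
  \<open>\<sigma> U\<^sub>k\<close> is maximal, each product of a difference with an off-diagonal stiffness entry has the sign that
  keeps diffusion from acting outwards, and the flux condition makes the whole right-hand side
  strictly inward.\<close>

lemma eventually_below_barrier:
  fixes U V :: "real \<Rightarrow> point \<Rightarrow> real^'r::finite" and \<sigma> :: real
  assumes stiff: "\<And>q. q \<noteq> p \<Longrightarrow> stiffness q p \<le> 0" and d: "d k > 0" and f: "continuous_on UNIV f"
    and U: "\<And>q k. q \<in> vertices \<K> \<Longrightarrow> continuous_on {0..T} (\<lambda>t. U t q $ k)"
    and weak: "has_weak_derivative T (\<lambda>t. U t p $ k) (\<lambda>t. V t p $ k)"
    and V: "AE t in lebesgue_on {0..T}. V t p $ k = nodal_rhs d f (U t) p k"
    and p: "p \<in> vertices \<K>" and t0: "0 \<le> t0" "t0 < T"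
    and max: "\<And>q. q \<in> vertices \<K> \<Longrightarrow> \<sigma> * U t0 q $ k \<le> \<sigma> * U t0 p $ k"
    and flux: "\<sigma> * f (U t0 p) $ k < 0"
  shows "eventually (\<lambda>t. \<sigma> * U t p $ k \<le> \<sigma> * U t0 p $ k) (at_right t0)"
proof (rule weak_derivative_neg_imp_eventually_le[where g="\<lambda>t. \<sigma> * nodal_rhs d f (U t) p k", OF _ _ _ _ t0])
  show "continuous_on {0..T} (\<lambda>t. \<sigma> * U t p $ k)"
    by (intro continuous_intros U p)
  show "has_weak_derivative T (\<lambda>t. \<sigma> * U t p $ k) (\<lambda>t. \<sigma> * V t p $ k)"
    by (rule has_weak_derivative_cmult[OF weak])
  show "AE t in lebesgue_on {0..T}. \<sigma> * V t p $ k = \<sigma> * nodal_rhs d f (U t) p k"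
    using V by eventually_elim simp
  have "continuous_on {0..T} (\<lambda>t. \<chi> k. U t p $ k)"
    by (intro continuous_on_vec_lambda U p)
  then have "continuous_on {0..T} (\<lambda>t. f (U t p))"
    by (intro continuous_on_compose2[OF f]) simp_all
  then show "continuous_on {0..T} (\<lambda>t. \<sigma> * nodal_rhs d f (U t) p k)"
    unfolding nodal_rhs_def by (intro continuous_intros U p)
  have "\<sigma> * ((U t0 q $ k - U t0 p $ k) * stiffness q p) \<ge> 0" if "q \<in> vertices \<K>" for q
  proof (cases "q = p")
    case False
    have "(\<sigma> * (U t0 q $ k - U t0 p $ k)) * stiffness q p \<ge> 0"
      using max[OF that] stiff[OF False] by (intro mult_nonpos_nonpos) (simp_all add: right_diff_distrib)
    then show ?thesis by (simp add: mult.assoc)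
  qed simp
  then have "(\<Sum>q\<in>vertices \<K>. \<sigma> * ((U t0 q $ k - U t0 p $ k) * stiffness q p)) \<ge> 0"
    by (intro sum_nonneg)
  then have "\<sigma> * (\<Sum>q\<in>vertices \<K>. (U t0 q $ k - U t0 p $ k) * stiffness q p) \<ge> 0"
    by (simp only: sum_distrib_left)
  then have "d k / lumped_mass p * (\<sigma> * (\<Sum>q\<in>vertices \<K>. (U t0 q $ k - U t0 p $ k) * stiffness q p)) \<ge> 0"
    by (intro mult_nonneg_nonneg[OF less_imp_le[OF divide_pos_pos[OF d lumped_mass_pos[OF p]]]])
  then show "\<sigma> * nodal_rhs d f (U t0) p k < 0"
    using flux unfolding nodal_rhs_def right_diff_distrib mult.left_commute[of \<sigma> "d k / _"] by linarith
qed

text \<open>The set \<open>S\<close> of times at which all nodal values are admissible is closed and can be prolonged to the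
  right, since each of the finitely many bounds is either strict, hence persists, or attained, and then
  \<open>eventually_below_barrier\<close> applies.\<close>

lemma invariant_region_if_stiffness_nonpos:
  fixes d :: "'r::finite \<Rightarrow> real" and f :: "real^'r \<Rightarrow> real^'r"
  assumes stiff: "\<And>p q. p \<noteq> q \<Longrightarrow> stiffness p q \<le> 0"
    and d: "\<And>k. d k > 0" and f: "continuous_on UNIV f"
    and flux: "\<And>u n. u \<in> frontier (hyper_rectangle m M) \<Longrightarrow> n \<in> outward_normals m M u \<Longrightarrow>
                 f u \<bullet> n < 0"
    and sol: "semidiscrete_solution \<K> d f T U"
    and init: "\<And>x. x \<in> \<Union>\<K> \<Longrightarrow> U 0 x \<in> hyper_rectangle m M"
    and T: "T > 0" and t: "t \<in> {0..T}" and x: "x \<in> \<Union>\<K>"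
  shows "U t x \<in> hyper_rectangle m M"
proof -
  obtain V where sol: "\<forall>k.
        L2_fe \<K> T (\<lambda>t x. U t x $ k) \<and> L2_fe \<K> T (\<lambda>t x. V t x $ k) \<and>
        (\<forall>x\<in>\<Union>\<K>. continuous_on {0..T} (\<lambda>t. U t x $ k) \<and>
                  has_weak_derivative T (\<lambda>t. U t x $ k) (\<lambda>t. V t x $ k)) \<and>
        (\<forall>\<phi>\<in>fe_space \<K>. AE t in lebesgue_on {0..T}.
           surface_integral \<K> (\<lambda>K. nodal_interpolant \<K> (\<lambda>x. V t x $ k * \<phi> x))
           + d k * surface_integral \<K> (\<lambda>K x.
               tangential_gradient K (\<lambda>y. U t y $ k) x \<bullet> tangential_gradient K \<phi> x)
           = surface_integral \<K> (\<lambda>K. nodal_interpolant \<K> (\<lambda>x. f (U t x) $ k * \<phi> x)))"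
    using sol[unfolded semidiscrete_solution_def] by (rule exE)
  note sol = sol[THEN spec]
  have fe: "(\<lambda>x. U t x $ k) \<in> fe_space \<K>" if "t \<in> {0..T}" for k t
    using sol[of k, THEN conjunct1] that unfolding L2_fe_def by simp
  have cont: "continuous_on {0..T} (\<lambda>t. U t x $ k)"
    and weak: "has_weak_derivative T (\<lambda>t. U t x $ k) (\<lambda>t. V t x $ k)" if "x \<in> \<Union>\<K>" for k x
    using sol[of k, THEN conjunct2, THEN conjunct2, THEN conjunct1, THEN bspec, OF that] by blast+
  note eq = sol[THEN conjunct2, THEN conjunct2, THEN conjunct2, THEN bspec]
  have vx: "p \<in> \<Union>\<K>" if "p \<in> vertices \<K>" for p
    using that by (auto simp: vertices_def extreme_point_of_def)
  have V: "AE t in lebesgue_on {0..T}. V t p $ k = nodal_rhs d f (U t) p k"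
    if p: "p \<in> vertices \<K>" for p k
    using eq[OF nodal_basis_fe, of k p] AE_space
  proof eventually_elim
    case (elim t)
    then have "t \<in> {0..T}" by simp
    show ?case by (rule nodal_equation[where u="U t" and v="V t" and d=d and f=f and k=k, OF fe[OF \<open>t \<in> {0..T}\<close>] p elim(1)])
  qed
  define S where "S = {t \<in> {0..T}. \<forall>p\<in>vertices \<K>. U t p \<in> hyper_rectangle m M}"
  have "{0..T} \<subseteq> S"
  proof (rule real_interval_continuation)
    show "0 \<in> S" using T init vx by (auto simp: S_def)
    show "S \<subseteq> {0..T}" by (auto simp: S_def)
    have "closed ({0..T} \<inter> (\<lambda>t. U t p) -` hyper_rectangle m M)" if "p \<in> vertices \<K>" for p
    proof (rule continuous_closed_preimage[OF _ _ closed_hyper_rectangle])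
      have "continuous_on {0..T} (\<lambda>t. \<chi> k. U t p $ k)"
        by (intro continuous_on_vec_lambda cont vx that)
      then show "continuous_on {0..T} (\<lambda>t. U t p)" by simp
    qed simp
    then have "closed ({0..T} \<inter> (\<Inter>p\<in>vertices \<K>. {0..T} \<inter> (\<lambda>t. U t p) -` hyper_rectangle m M))"
      by (intro closed_Int closed_INT) auto
    moreover have "{0..T} \<inter> (\<Inter>p\<in>vertices \<K>. {0..T} \<inter> (\<lambda>t. U t p) -` hyper_rectangle m M) = S"
      by (auto simp: S_def)
    ultimately show "closed S" by simp
  next
    fix t0 assume "t0 \<in> S" "t0 < T"
    then have t0: "0 \<le> t0" "t0 < T" and inside: "\<And>p. p \<in> vertices \<K> \<Longrightarrow> U t0 p \<in> hyper_rectangle m M"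
      by (auto simp: S_def)
    have lim: "((\<lambda>t. U t p $ k) \<longlongrightarrow> U t0 p $ k) (at_right t0)" if "p \<in> vertices \<K>" for p k
    proof -
      have "((\<lambda>t. U t p $ k) \<longlongrightarrow> U t0 p $ k) (at t0 within {0..T})"
        using cont[OF vx[OF that], of k] t0 by (simp add: continuous_on)
      then have "((\<lambda>t. U t p $ k) \<longlongrightarrow> U t0 p $ k) (at t0 within {t0..T})"
        by (rule tendsto_within_subset) (use t0 in simp)
      then show ?thesis using t0 by (simp add: at_within_Icc_at_right)
    qed
    have upper: "eventually (\<lambda>t. ereal (U t p $ k) \<le> M k) (at_right t0)" if p: "p \<in> vertices \<K>" for p k
    proof (cases "ereal (U t0 p $ k) = M k")
      case True
      have "eventually (\<lambda>t. 1 * U t p $ k \<le> 1 * U t0 p $ k) (at_right t0)"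
      proof (rule eventually_below_barrier[where d=d and f=f and U=U and V=V and k=k, OF _ d f _ weak[OF vx[OF p]] V[OF p] p t0])
        show "stiffness q p \<le> 0" if "q \<noteq> p" for q using that by (rule stiff)
        show "continuous_on {0..T} (\<lambda>t. U t q $ k)" if "q \<in> vertices \<K>" for q k
          by (rule cont[OF vx[OF that]])
        show "1 * U t0 q $ k \<le> 1 * U t0 p $ k" if "q \<in> vertices \<K>" for q
          using inside[OF that] True[symmetric] by (auto simp: hyper_rectangle_def dest: spec[of _ k])
        show "1 * f (U t0 p) $ k < 0" using flux_at_face(1)[OF flux inside[OF p] True] by simp
      qed
      then show ?thesis by eventually_elim (simp add: True[symmetric])
    next
      case False
      then have "ereal (U t0 p $ k) < M k" using inside[OF p] by (auto simp: hyper_rectangle_def less_le)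
      moreover have "((\<lambda>t. ereal (U t p $ k)) \<longlongrightarrow> ereal (U t0 p $ k)) (at_right t0)"
        using lim[OF p] by simp
      ultimately have "eventually (\<lambda>t. ereal (U t p $ k) < M k) (at_right t0)"
        by (rule order_tendstoD(2)[rotated])
      then show ?thesis by (rule eventually_mono) (rule less_imp_le)
    qed
    have lower: "eventually (\<lambda>t. m k \<le> ereal (U t p $ k)) (at_right t0)" if p: "p \<in> vertices \<K>" for p k
    proof (cases "ereal (U t0 p $ k) = m k")
      case True
      have "eventually (\<lambda>t. - 1 * U t p $ k \<le> - 1 * U t0 p $ k) (at_right t0)"
      proof (rule eventually_below_barrier[where d=d and f=f and U=U and V=V and k=k, OF _ d f _ weak[OF vx[OF p]] V[OF p] p t0])
        show "stiffness q p \<le> 0" if "q \<noteq> p" for q using that by (rule stiff)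
        show "continuous_on {0..T} (\<lambda>t. U t q $ k)" if "q \<in> vertices \<K>" for q k
          by (rule cont[OF vx[OF that]])
        show "- 1 * U t0 q $ k \<le> - 1 * U t0 p $ k" if "q \<in> vertices \<K>" for q
          using inside[OF that] True[symmetric] by (auto simp: hyper_rectangle_def dest: spec[of _ k])
        show "- 1 * f (U t0 p) $ k < 0" using flux_at_face(2)[OF flux inside[OF p] True] by simp
      qed
      then show ?thesis by eventually_elim (simp add: True[symmetric])
    next
      case False
      then have "m k < ereal (U t0 p $ k)" using inside[OF p] by (auto simp: hyper_rectangle_def less_le)
      moreover have "((\<lambda>t. ereal (U t p $ k)) \<longlongrightarrow> ereal (U t0 p $ k)) (at_right t0)"
        using lim[OF p] by simp
      ultimately have "eventually (\<lambda>t. m k < ereal (U t p $ k)) (at_right t0)"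
        by (rule order_tendstoD(1)[rotated])
      then show ?thesis by (rule eventually_mono) (rule less_imp_le)
    qed
    have "eventually (\<lambda>t. \<forall>p\<in>vertices \<K>. U t p \<in> hyper_rectangle m M) (at_right t0)"
      unfolding hyper_rectangle_def mem_Collect_eq
      by (intro eventually_ball_finite finite_vertices ballI eventually_all_finite eventually_conj upper lower)
    moreover have "eventually (\<lambda>t. t \<in> {t0<..<T}) (at_right t0)"
      using t0(2) by (rule eventually_at_right_real)
    ultimately show "eventually (\<lambda>t. t \<in> S) (at_right t0)"
      by eventually_elim (use t0 in \<open>auto simp: S_def\<close>)
  qed
  then have nodes: "U t p \<in> hyper_rectangle m M" if "p \<in> vertices \<K>" for p
    using t that by (auto simp: S_def)
  have "m k \<le> ereal (U t x $ k) \<and> ereal (U t x $ k) \<le> M k" for k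
  proof -
    obtain p q where p: "p \<in> vertices \<K>" "U t x $ k \<le> U t p $ k"
      and q: "q \<in> vertices \<K>" "U t q $ k \<le> U t x $ k"
      using fe_extrema_at_vertices[OF fe[OF t] x, of k] by blast
    have "m k \<le> ereal (U t q $ k)" "ereal (U t p $ k) \<le> M k"
      using nodes[OF p(1)] nodes[OF q(1)] by (auto simp: hyper_rectangle_def)
    then show ?thesis using p(2) q(2) by (meson ereal_less_eq(3) order_trans)
  qed
  then show ?thesis by (simp add: hyper_rectangle_def)
qed

end

theorem theorem4:
  fixes \<Gamma> W :: "point set" and \<delta> :: "point \<Rightarrow> real"
    and h :: real and \<K> :: "point set set"
    and d :: "'r::finite \<Rightarrow> real" and f :: "real^'r \<Rightarrow> real^'r"
    and m M :: "'r \<Rightarrow> ereal"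
  assumes surface: "signed_distance_surface \<Gamma> W \<delta>"
    and h: "h > 0"
    and triangulated: "triangulated_surface h \<K> \<Gamma> W \<delta>"
    and angles: "angle_condition \<K>"
    and diffusion: "\<And>k. d k > 0"
    and f_C2: "Ck_on 2 f UNIV"
    and f_lipschitz: "\<exists>L. L-lipschitz_on (hyper_rectangle m M) f"
    and flux: "\<And>u n. u \<in> frontier (hyper_rectangle m M) \<Longrightarrow> n \<in> outward_normals m M u \<Longrightarrow>
                 f u \<bullet> n < 0"
  shows "invariant_region \<K> d f (hyper_rectangle m M)"
proof -
  have triangles: "triangulation \<K>" "\<forall>K\<in>\<K>. 2 simplex K \<and> diameter K \<le> h"
    and closed: "\<forall>K\<in>\<K>. \<forall>e. e edge_of K \<longrightarrow> card {L \<in> \<K>. e edge_of L} = 2"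
    using triangulated unfolding triangulated_surface_def by blast+
  interpret triangle_mesh \<K>
    by unfold_locales (use triangles in \<open>unfold triangulation_def, blast+\<close>)
  have stiff: "stiffness p q \<le> 0" if "p \<noteq> q" for p q
    by (rule stiffness_nonpos[OF _ angles that]) (use closed in blast)
  have diff: "\<forall>x\<in>UNIV. f differentiable (at x)"
    using f_C2 unfolding numeral_2_eq_2 Ck_on.simps(2)[of "Suc 0"] by (rule conjunct1)
  have f: "continuous_on UNIV f"
    by (rule continuous_at_imp_continuous_on) (use diff differentiable_imp_continuous_within in blast)
  show ?thesis
    unfolding invariant_region_def unique_semidiscrete_solution_def
  proof (intro allI impI ballI, elim conjE)
    fix T U t x
    assume *: "T > 0" "t \<in> {0..T}" "x \<in> \<Union>\<K>" "semidiscrete_solution \<K> d f T U"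
      and init: "\<forall>x\<in>\<Union>\<K>. U 0 x \<in> hyper_rectangle m M"
    show "U t x \<in> hyper_rectangle m M"
    proof (rule invariant_region_if_stiffness_nonpos[where d=d and f=f, OF _ _ f _ *(4) _ *(1-3)])
      show "stiffness p q \<le> 0" if "p \<noteq> q" for p q using that by (rule stiff)
      show "d k > 0" for k by (rule diffusion)
      show "f u \<bullet> n < 0" if "u \<in> frontier (hyper_rectangle m M)" "n \<in> outward_normals m M u" for u n
        using that by (rule flux)
    qed (use init in blast)
  qed
qed

end
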